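(* Let $f_i:\mathbb{R}^p\to\mathbb{R}$ be differentiable with $L_{f_i}$-Lipschitz gradient ($L_{f_i}>0$) and $r_i:\mathbb{R}^p\to\mathbb{R}\cup\{+\infty\}$ be such that $f_i+r_i$ is proper, lower semicontinuous and coercive, $i=1,\dots,n$. Let $L_f=\max_iL_{f_i}$ and let $W$ be a mixing matrix (see context). Suppose that for each $i$ there are constants $B_i,B_{r_i}>0$ with $\|\nabla f_i(x)\|\le B_i$ for all $x\in\mathbb{R}^p$ and $\|\xi_i\|\le B_{r_i}$ for all $x\in\mathbb{R}^p$ and $\xi_i\in\partial r_i(x)$. Assume that either all $r_i$ are convex, or $\lambda_n(W)>0$. Let $0<\epsilon\le1$, $\alpha_k=\frac{1}{L_f(k+1)^\epsilon}$, let ${\bf x}^0\in\mathbb{R}^{n\times p}$ be arbitrary, and let $\{{\bf x}^k\}$ be a sequence generated by Prox-DGD: $${\bf x}^{k+1}\in\mathrm{prox}_{\alpha_kr}\big(W{\bf x}^k-\alpha_k\nabla{\bf f}({\bf x}^k)\big),\qquad k=0,1,\dots$$ Let $\hat{\mathcal{L}}_{\alpha_k}({\bf x})=\sum_{i=1}^nf_i({\bf x}_{(i)})+\frac{1}{2\alpha_k}\|{\bf x}\|_{I-W}^2+r({\bf x})$, and for $k\ge0$ let $\xi^{k+1}\in\partial r({\bf x}^{k+1})$ be the subgradient determined by the proximal step, i.e. ${\bf x}^{k+1}=W{\bf x}^k-\alpha_k(\nabla{\bf f}({\bf x}^k)+\xi^{k+1})$. Then: (a) $\{\hat{\mathcal{L}}_{\alpha_k}({\bf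 x}^k)\}$ and $\{\sum_{i=1}^n(f_i({\bf x}^k_{(i)})+r_i({\bf x}^k_{(i)}))\}$ converge to the same limit; (b) $\sum_{k=0}^\infty\big(\alpha_k^{-1}(1+\lambda_n(W))-L_f\big)\|{\bf x}^{k+1}-{\bf x}^k\|^2<\infty$ when the $r_i$ are convex; and $\sum_{k=0}^\infty\big(\alpha_k^{-1}\lambda_n(W)-L_f\big)\|{\bf x}^{k+1}-{\bf x}^k\|^2<\infty$ when the $r_i$ are not necessarily convex (with $\lambda_n(W)>0$); (c) if there exist a constant $L_r>0$ and an integer $k_0>0$ such that $\|\xi^{k+1}-\xi^k\|\le L_r\|{\bf x}^{k+1}-{\bf x}^k\|$ for all $k>k_0$, then $$\lim_{k\to\infty}{\bf 1}^T\big(\nabla{\bf f}({\bf x}^k)+\xi^{k+1}\big)=0,$$ and any limit point of $\{{\bf x}^k\}$ is a stationary point of the problem $$\min_{{\bf x}\in\mathbb{R}^{n\times p}}\ \sum_{i=1}^n\big(f_i({\bf x}_{(i)})+r_i({\bf x}_{(i)})\big)\quad\text{subject to } {\bf x}_{(i)}={\bf x}_{(j)}\ \ \forall(i,j)\in\mathcal{E};$$ (d) in addition, if $\{{\bf x}^k\}$ has an isolated accumulation point, then $\{{\bf x}^k\}$ converges; (e) furthermore, if all $f_i$ and $r_i$ are convex and $\lambda_n(W)>0$, then with $\bar s({\bf x})=\sum_{i=1}^n(f_i({\bf x}_{(i)})+r_i({\bf x}_{(i)}))$, $\bar{\bf x}^k=\frac1n{\bf 1}{\bf 1}^T{\bf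 x}^k$, $s_{\mathrm{opt}}$ the optimal value of the problem in (c), and $$\bar s^K=\frac{\sum_{k=0}^K\alpha_k\bar s(\bar{\bf x}^{k+1})}{\sum_{k=0}^K\alpha_k},$$ the sequence $\{\bar s^K\}$ converges to $s_{\mathrm{opt}}$ at the following rates as $K\to\infty$: $\mathcal{O}(\frac1{K^\epsilon})$ if $0<\epsilon<1/2$; $\mathcal{O}(\frac{\ln K}{\sqrt K})$ if $\epsilon=1/2$; $\mathcal{O}(\frac{1}{K^{1-\epsilon}})$ if $1/2<\epsilon<1$; $\mathcal{O}(\frac1{\ln K})$ if $\epsilon=1$.
   Context: Notation. $\mathcal{G}=(\mathcal{V},\mathcal{E})$ is a connected undirected graph with $\mathcal{V}=\{1,\dots,n\}$. For ${\bf x}\in\mathbb{R}^{n\times p}$, ${\bf x}_{(i)}\in\mathbb{R}^p$ is its $i$-th row (as a column vector). $\|\cdot\|$ is the Frobenius norm (Euclidean norm for vectors), $\langle\cdot,\cdot\rangle$ the corresponding inner product, and $\|X\|_G^2=\langle X,GX\rangle$ for symmetric positive semidefinite $G\in\mathbb{R}^{n\times n}$. $I$ is the $n\times n$ identity, ${\bf 1}\in\mathbb{R}^n$ the all-ones vector. $\nabla{\bf f}({\bf x})\in\mathbb{R}^{n\times p}$ is the matrix whose $i$-th row is $\nabla f_i({\bf x}_{(i)})^T$, and $r({\bf x})=\sum_{i=1}^nr_i({\bf x}_{(i)})$. The proximal operator is $\mathrm{prox}_{\alpha r}({\bf x})=\mathrm{argmin}_{{\bf u}\in\mathbb{R}^{n\times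 p}}\{\alpha r({\bf u})+\frac12\|{\bf u}-{\bf x}\|^2\}$ (any minimizer may be chosen; minimizers are assumed to exist). A function $h$ is coercive if $\|u\|\to\infty$ implies $h(u)\to+\infty$. $\partial$ denotes the limiting subdifferential (the convex subdifferential for convex functions). Mixing matrix: $W=[w_{ij}]\in\mathbb{R}^{n\times n}$ such that (1) $w_{ij}=0$ if $i\ne j$ and $(i,j)\notin\mathcal{E}$, and $w_{ij}>0$ otherwise; (2) $W=W^T$; (3) $\mathrm{null}(I-W)=\mathrm{span}\{{\bf 1}\}$; (4) $I\succeq W\succ -I$. Its eigenvalues are $1=\lambda_1(W)>\lambda_2(W)\ge\dots\ge\lambda_n(W)>-1$. Stationary point of the constrained problem: a point ${\bf x}^*$ all of whose rows equal a common $x^*\in\mathbb{R}^p$ and for which there are $\xi_i\in\partial r_i(x^* )$ with $\sum_{i=1}^n(\nabla f_i(x^* )+\xi_i)=0$. *)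

theory Defs
  imports "HOL-Analysis.Analysis" "HOL-Library.Landau_Symbols"
begin

text \<open>
  Conventions.  The vertex set \<open>{1,\<dots>,n}\<close> is the finite type \<open>'n\<close>, so \<open>n = CARD('n)\<close>.  An
  \<open>n \<times> p\<close> real matrix is an element of \<open>real^'p^'n\<close>: its \<open>i\<close>-th row is \<open>x $ i\<close>, and the norm
  and inner product of this type are the Frobenius ones.  Functions with values in
  \<open>\<real> \<union> {+\<infinity>}\<close> are functions into \<^typ>\<open>ereal\<close> that avoid \<open>-\<infinity>\<close>.
\<close>

definition proper_fun :: "('a \<Rightarrow> ereal) \<Rightarrow> bool" where
  "proper_fun h \<longleftrightarrow> (\<forall>x. h x \<noteq> -\<infinity>) \<and> (\<exists>x. h x \<noteq> \<infinity>)"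

definition lower_semicontinuous :: "('a::topological_space \<Rightarrow> ereal) \<Rightarrow> bool" where
  "lower_semicontinuous h \<longleftrightarrow> (\<forall>x. h x \<le> Liminf (at x) h)"

definition coercive :: "('a::real_normed_vector \<Rightarrow> ereal) \<Rightarrow> bool" where
  "coercive h \<longleftrightarrow> (h \<longlongrightarrow> \<infinity>) at_infinity"

text \<open>Intended for functions that avoid \<open>-\<infinity>\<close>, so that the right-hand side is never \<open>\<infinity> - \<infinity>\<close>.\<close>

definition convex_fun :: "('a::real_vector \<Rightarrow> ereal) \<Rightarrow> bool" where
  "convex_fun h \<longleftrightarrow>
     (\<forall>x y. \<forall>t::real. 0 < t \<and> t < 1 \<longrightarrow>
        h ((1 - t) *\<^sub>R x + t *\<^sub>R y) \<le> ereal (1 - t) * h x + ereal t * h y)"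

text \<open>
  Regular (Frechet) and limiting (Mordukhovich) subdifferentials; both are empty outside the
  effective domain.  For a proper convex function the limiting subdifferential is the
  subdifferential of convex analysis, so a single definition serves both cases.
\<close>

definition regular_subdiff :: "('a::real_inner \<Rightarrow> ereal) \<Rightarrow> 'a \<Rightarrow> 'a set" where
  "regular_subdiff h x =
     {v. \<bar>h x\<bar> \<noteq> \<infinity> \<and>
         0 \<le> Liminf (at x) (\<lambda>y. (h y - h x - ereal (v \<bullet> (y - x))) / ereal (norm (y - x)))}"

definition limiting_subdiff :: "('a::real_inner \<Rightarrow> ereal) \<Rightarrow> 'a \<Rightarrow> 'a set" where
  "limiting_subdiff h x =
     {v. \<bar>h x\<bar> \<noteq> \<infinity> \<and>
         (\<exists>u w. u \<longlonglongrightarrow> x \<and> (\<lambda>k. h (u k)) \<longlonglongrightarrow> h x \<and>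
                (\<forall>k::nat. w k \<in> regular_subdiff h (u k)) \<and> w \<longlonglongrightarrow> v)}"

definition prox :: "real \<Rightarrow> ('a::real_normed_vector \<Rightarrow> ereal) \<Rightarrow> 'a \<Rightarrow> 'a set" where
  "prox \<alpha> h x =
     {u. is_arg_min (\<lambda>u. ereal \<alpha> * h u + ereal (1/2 * (norm (u - x))\<^sup>2)) (\<lambda>_. True) u}"

definition connected_undirected_graph :: "('n \<times> 'n) set \<Rightarrow> bool" where
  "connected_undirected_graph E \<longleftrightarrow> sym E \<and> (\<forall>i j. (i, j) \<in> E\<^sup>*)"

definition pos_semidef :: "real^'n^'n \<Rightarrow> bool" where
  "pos_semidef A \<longleftrightarrow> transpose A = A \<and> (\<forall>v. 0 \<le> v \<bullet> (A *v v))"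

definition pos_def :: "real^'n^'n \<Rightarrow> bool" where
  "pos_def A \<longleftrightarrow> transpose A = A \<and> (\<forall>v. v \<noteq> 0 \<longrightarrow> 0 < v \<bullet> (A *v v))"

text \<open>In \<^typ>\<open>real^'n\<close> the constant \<open>1\<close> is the all-ones vector; the identity matrix is \<open>mat 1\<close>.\<close>

definition mixing_matrix :: "('n \<times> 'n) set \<Rightarrow> real^'n^'n \<Rightarrow> bool" where
  "mixing_matrix E W \<longleftrightarrow>
     (\<forall>i j. if i \<noteq> j \<and> (i, j) \<notin> E then W $ i $ j = 0 else W $ i $ j > 0) \<and>
     W = transpose W \<and>
     {v. (mat 1 - W) *v v = 0} = span {1} \<and>
     pos_semidef (mat 1 - W) \<and> pos_def (W - (- mat 1))"

text \<open>For a symmetric matrix the set of eigenvalues below is finite and nonempty.\<close>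

definition min_eigenvalue :: "real^'n^'n \<Rightarrow> real" where
  "min_eigenvalue A = Min {l. \<exists>v. v \<noteq> 0 \<and> A *v v = l *\<^sub>R v}"

definition separable_sum :: "('n::finite \<Rightarrow> real^'p \<Rightarrow> ereal) \<Rightarrow> real^'p^'n \<Rightarrow> ereal" where
  "separable_sum r x = (\<Sum>i\<in>UNIV. r i (x $ i))"

definition stacked_grad :: "('n::finite \<Rightarrow> real^'p \<Rightarrow> real^'p) \<Rightarrow> real^'p^'n \<Rightarrow> real^'p^'n" where
  "stacked_grad g x = (\<chi> i. g i (x $ i))"

definition objective ::
  "('n::finite \<Rightarrow> real^'p \<Rightarrow> real) \<Rightarrow> ('n \<Rightarrow> real^'p \<Rightarrow> ereal) \<Rightarrow> real^'p^'n \<Rightarrow> ereal" where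
  "objective f r x = (\<Sum>i\<in>UNIV. ereal (f i (x $ i)) + r i (x $ i))"

definition sq_seminorm :: "real^'n^'n \<Rightarrow> real^'p^'n \<Rightarrow> real" where
  "sq_seminorm G x = x \<bullet> (G ** x)"

definition lyapunov ::
  "real^'n^'n \<Rightarrow> ('n \<Rightarrow> real^'p \<Rightarrow> real) \<Rightarrow> ('n \<Rightarrow> real^'p \<Rightarrow> ereal) \<Rightarrow>
   real \<Rightarrow> real^'p^'n \<Rightarrow> ereal" where
  "lyapunov W f r \<alpha> x =
     ereal (\<Sum>i\<in>UNIV. f i (x $ i)) + ereal (1 / (2 * \<alpha>) * sq_seminorm (mat 1 - W) x)
       + separable_sum r x"

definition optimal_value ::
  "('n \<times> 'n) set \<Rightarrow> ('n::finite \<Rightarrow> real^'p \<Rightarrow> real) \<Rightarrow> ('n \<Rightarrow> real^'p \<Rightarrow> ereal) \<Rightarrow> ereal" where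
  "optimal_value E f r = (INF x \<in> {x. \<forall>(i, j)\<in>E. x $ i = x $ j}. objective f r x)"

definition stationary_point ::
  "('n::finite \<Rightarrow> real^'p \<Rightarrow> real^'p) \<Rightarrow> ('n \<Rightarrow> real^'p \<Rightarrow> ereal) \<Rightarrow> real^'p^'n \<Rightarrow> bool" where
  "stationary_point g r x \<longleftrightarrow>
     (\<exists>z. (\<forall>i. x $ i = z) \<and>
          (\<exists>\<xi>. (\<forall>i. \<xi> i \<in> limiting_subdiff (r i) z) \<and> (\<Sum>i\<in>UNIV. g i z + \<xi> i) = 0))"

definition row_average :: "real^'p^'n \<Rightarrow> real^'p^'n" where
  "row_average x = (1 / real CARD('n)) *\<^sub>R ((\<chi> i j. 1) ** x)"

definition ergodic_value ::
  "('n::finite \<Rightarrow> real^'p \<Rightarrow> real) \<Rightarrow> ('n \<Rightarrow> real^'p \<Rightarrow> ereal) \<Rightarrow>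
   (nat \<Rightarrow> real) \<Rightarrow> (nat \<Rightarrow> real^'p^'n) \<Rightarrow> nat \<Rightarrow> ereal" where
  "ergodic_value f r \<alpha> x K =
     (\<Sum>k\<le>K. ereal (\<alpha> k) * objective f r (row_average (x (Suc k)))) / ereal (\<Sum>k\<le>K. \<alpha> k)"

definition limit_points :: "(nat \<Rightarrow> 'a::topological_space) \<Rightarrow> 'a set" where
  "limit_points x = {l. \<exists>\<phi>. strict_mono \<phi> \<and> (x \<circ> \<phi>) \<longlonglongrightarrow> l}"

text \<open>
  The limit is required to be finite, so the terms are finite from some index on, and the
  conversion to real numbers does not affect the asymptotic statement.
\<close>

definition converges_at_rate :: "(nat \<Rightarrow> ereal) \<Rightarrow> ereal \<Rightarrow> (nat \<Rightarrow> real) \<Rightarrow> bool" where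
  "converges_at_rate s l \<rho> \<longleftrightarrow>
     \<bar>l\<bar> \<noteq> \<infinity> \<and> s \<longlonglongrightarrow> l \<and> (\<lambda>K. real_of_ereal (s K - l)) \<in> O(\<rho>)"

end

theory Submission
  imports Defs
begin

text \<open>
  Why the theorem holds.  The boundedness of the subgradients is a strong hypothesis: together with
  coercivity it makes every \<open>r i\<close> a finite, globally Lipschitz function
  (\<open>bounded_subgradients_imp_Lipschitz\<close>).  So the whole problem is one about real-valued Lipschitz
  functions, and the subgradients at the iterates are exactly the residuals of the proximal steps.

  The direction \<open>\<nabla>f + \<xi>\<close> is therefore bounded.  The mixing matrix contracts the deviation of an iterate
  from the average of its rows, so this deviation, and with it the length of a step, is \<open>O(\<alpha> k)\<close>
  (\<open>consensus_error\<close>, \<open>step_length\<close>).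

  Each iteration is a proximal gradient step for the Lyapunov function with penalty parameter
  \<open>\<alpha> k\<close>, which yields descent by the amounts whose summability is claimed (\<open>lyap_descent\<close>).  Changing
  the parameter from \<open>\<alpha> k\<close> to \<open>\<alpha> (Suc k)\<close> costs at most a multiple of \<open>\<alpha> k - \<alpha> (Suc k)\<close>, a telescoping
  error; hence the Lyapunov values converge and the decrements are summable.  The penalty is
  \<open>O(\<alpha> k)\<close>, so the objective values have the same limit (\<open>lyap_convergence\<close>).

  Averaging the iteration over the rows removes the mixing matrix: the average moves by \<open>\<alpha> k\<close> times
  the average direction \<open>v k\<close>.  Summability of the decrements gives \<open>(\<Sum>k. \<alpha> k * (norm (v k))\<^sup>2) < \<infinity>\<close>, and
  if \<open>\<xi>\<close> varies in a Lipschitz way then \<open>v\<close> changes by \<open>O(\<alpha> k)\<close> per step.  As the step sizes are not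
  summable, \<open>v\<close> tends to zero (\<open>slowly_varying_square_summable_tendsto_0\<close>), and continuity of the
  \<open>r i\<close> lets the subgradients pass to the limit along a convergent subsequence.  Vanishing steps
  also imply convergence to any isolated limit point.

  In the convex case the squared distance to a minimiser decreases by \<open>2 * \<alpha> k\<close> times the objective
  gap at the averaged iterate, up to \<open>O((\<alpha> k)\<^sup>2)\<close> (\<open>ergodic_step\<close>).  Telescoping bounds the ergodic gap
  by a constant times \<open>(1 + (\<Sum>k\<le>K. (\<alpha> k)\<^sup>2)) / (\<Sum>k\<le>K. \<alpha> k)\<close>, and the four rates are the orders
  of this quotient.
\<close>

section \<open>Subgradients\<close>

text \<open>
  The difference quotient is then at least \<open>- c * norm (u - x)\<close>, which tends to zero.  Every
  subgradient below is recognised in this way: minimality in a proximal step, and minimality of a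
  function plus a multiple of a norm, both yield minorants with a quadratic error.
\<close>

lemma regular_subdiffI_quadratic:
  fixes h :: "'a::euclidean_space \<Rightarrow> ereal"
  assumes hx: "h x = ereal a"
    and minorant: "\<And>u. h u \<ge> ereal (a + v \<bullet> (u - x) - c * (norm (u - x))\<^sup>2)"
  shows "v \<in> regular_subdiff h x"
proof -
  have "((\<lambda>u. - c * norm (u - x)) \<longlongrightarrow> - c * norm (x - x)) (at x)"
    by (intro tendsto_intros)
  then have "((\<lambda>u. ereal (- c * norm (u - x))) \<longlongrightarrow> ereal 0) (at x)"
    by (simp del: tendsto_mult_left_iff)
  then have lim: "Liminf (at x) (\<lambda>u. ereal (- c * norm (u - x))) = 0"
    by (simp add: lim_imp_Liminf zero_ereal_def)
  have "Liminf (at x) (\<lambda>u. ereal (- c * norm (u - x)))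
      \<le> Liminf (at x) (\<lambda>y. (h y - h x - ereal (v \<bullet> (y - x))) / ereal (norm (y - x)))"
  proof (rule Liminf_mono, unfold eventually_at_filter, rule always_eventually, intro allI impI)
    fix u assume "u \<noteq> x"
    then have pos: "norm (u - x) > 0" by simp
    show "ereal (- c * norm (u - x)) \<le> (h u - h x - ereal (v \<bullet> (u - x))) / ereal (norm (u - x))"
    proof (cases "h u")
      case (real b)
      have "a + v \<bullet> (u - x) - c * (norm (u - x))\<^sup>2 \<le> b"
        using minorant[of u] real by simp
      then have "- c * norm (u - x) * norm (u - x) \<le> b - a - v \<bullet> (u - x)"
        by (simp add: power2_eq_square)
      then have "- c * norm (u - x) \<le> (b - a - v \<bullet> (u - x)) / norm (u - x)"
        using pos by (simp add: pos_le_divide_eq)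
      then show ?thesis using real hx pos by simp
    next
      case PInf
      then show ?thesis using hx pos by simp
    next
      case MInf
      then show ?thesis using minorant[of u] by simp
    qed
  qed
  then show ?thesis
    unfolding regular_subdiff_def using hx lim by simp
qed

lemma regular_subdiff_subset_limiting: "regular_subdiff h x \<subseteq> limiting_subdiff h x"
proof
  fix v assume v: "v \<in> regular_subdiff h x"
  then have "\<bar>h x\<bar> \<noteq> \<infinity>" by (simp add: regular_subdiff_def)
  moreover have "\<exists>u w. u \<longlonglongrightarrow> x \<and> (\<lambda>k. h (u k)) \<longlonglongrightarrow> h x \<and>
                (\<forall>k::nat. w k \<in> regular_subdiff h (u k)) \<and> w \<longlonglongrightarrow> v"
    by (rule exI[of _ "\<lambda>_. x"], rule exI[of _ "\<lambda>_. v"]) (use v in auto)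
  ultimately show "v \<in> limiting_subdiff h x"
    unfolding limiting_subdiff_def by blast
qed

text \<open>
  At the point with parameter \<open>t\<close> on the segment from \<open>x\<close> to \<open>u\<close> the error is of order \<open>t\<^sup>2\<close>, while
  convexity compares the increments to first order in \<open>t\<close>; dividing by \<open>t\<close> and letting it tend to
  zero removes the error.  This serves both for the nonsmooth terms, whose minorant comes from
  the proximal step, and for the smooth ones, whose minorant comes from the Lipschitz gradient.
\<close>

lemma quadratic_minorant_imp_subgradient:
  fixes h :: "'a::real_inner \<Rightarrow> real"
  assumes conv: "convex_on UNIV h"
    and minorant: "\<And>u. h u \<ge> h x + v \<bullet> (u - x) - c * (norm (u - x))\<^sup>2"
  shows "h u \<ge> h x + v \<bullet> (u - x)"
proof -
  have "h x + v \<bullet> (u - x) - t * (c * (norm (u - x))\<^sup>2) \<le> h u" if t: "0 < t" "t < 1" for t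
  proof -
    define w where "w = (1 - t) *\<^sub>R x + t *\<^sub>R u"
    have wx: "w - x = t *\<^sub>R (u - x)" by (simp add: w_def algebra_simps)
    have "h w \<le> (1 - t) * h x + t * h u"
      using conv t unfolding convex_on_def w_def by auto
    moreover have "h w \<ge> h x + t * (v \<bullet> (u - x)) - c * (t * norm (u - x))\<^sup>2"
      using minorant[of w] t by (simp add: wx)
    ultimately have "t * (h x + v \<bullet> (u - x) - t * (c * (norm (u - x))\<^sup>2)) \<le> t * h u"
      by (simp add: algebra_simps power2_eq_square)
    then show ?thesis using t by simp
  qed
  then have "eventually (\<lambda>t. h x + v \<bullet> (u - x) - t * (c * (norm (u - x))\<^sup>2) \<le> h u) (at_right 0)"
    using eventually_at_right[of 0 "1::real"] by (auto intro!: exI[of _ 1])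
  moreover have "((\<lambda>t. h x + v \<bullet> (u - x) - t * (c * (norm (u - x))\<^sup>2)) \<longlongrightarrow>
      h x + v \<bullet> (u - x) - 0 * (c * (norm (u - x))\<^sup>2)) (at_right 0)"
    by (intro tendsto_intros)
  ultimately show ?thesis
    using tendsto_upperbound[of _ _ "at_right (0::real)"] by fastforce
qed

lemma convex_fun_ereal_iff: "convex_fun (\<lambda>u. ereal (h u)) \<longleftrightarrow> convex_on UNIV h"
proof
  assume c: "convex_fun (\<lambda>u. ereal (h u))"
  show "convex_on UNIV h"
  proof (rule convex_onI)
    fix t :: real and u v :: 'a
    assume "0 < t" "t < 1"
    then show "h ((1 - t) *\<^sub>R u + t *\<^sub>R v) \<le> (1 - t) * h u + t * h v"
      using c unfolding convex_fun_def by force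
  qed simp
next
  assume c: "convex_on UNIV h"
  show "convex_fun (\<lambda>u. ereal (h u))"
    unfolding convex_fun_def using convex_onD[OF c] by auto
qed

section \<open>Bounded subgradients and Lipschitz continuity\<close>

lemma lower_semicontinuous_sequentially:
  assumes "lower_semicontinuous h" and u: "u \<longlonglongrightarrow> x" and m: "(\<lambda>k. h (u k)) \<longlonglongrightarrow> m"
  shows "h x \<le> m"
proof (rule dense_le)
  fix y assume y: "y < h x"
  have "h x \<le> Liminf (at x) h"
    using assms(1) unfolding lower_semicontinuous_def by blast
  then have "eventually (\<lambda>z. y < h z) (at x)"
    using y less_LiminfD order.strict_trans2 by blast
  then have "eventually (\<lambda>z. y < h z) (nhds x)"
    using y by (auto simp: eventually_at_filter elim: eventually_mono)
  then have "eventually (\<lambda>k. y < h (u k)) sequentially"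
    using u unfolding filterlim_iff by blast
  then have "eventually (\<lambda>k. y \<le> h (u k)) sequentially"
    by (rule eventually_mono) simp
  then show "y \<le> m"
    using m by (intro tendsto_lowerbound) auto
qed

text \<open>
  Since \<open>c\<close> is bounded below, coercivity of \<open>h\<close> bounds every minimising sequence of \<open>h + c\<close>, and a
  convergent subsequence ends in a minimiser.  Keeping \<open>c\<close> apart from \<open>h\<close> allows \<open>c\<close> to be a norm
  minus a smooth function, or a sum of further objectives.
\<close>

lemma lower_semicontinuous_coercive_attains_min:
  fixes h :: "'a::euclidean_space \<Rightarrow> ereal" and c :: "'a \<Rightarrow> real"
  assumes lsc: "lower_semicontinuous h" and coer: "coercive h"
    and cont: "continuous_on UNIV c" and below: "\<And>u. b \<le> c u"
  shows "\<exists>z. \<forall>u. h z + ereal (c z) \<le> h u + ereal (c u)"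
proof -
  define k where "k = (\<lambda>u. h u + ereal (c u))"
  define m where "m = Inf (range k)"
  show ?thesis
  proof (cases "m = \<infinity>")
    case True
    then have "k u = \<infinity>" for u
      unfolding m_def by (metis rangeI top_ereal_def Inf_top_conv(2))
    then show ?thesis unfolding k_def by (metis order_refl)
  next
    case False
    then obtain q :: real where q: "m < ereal q"
      using less_PInf_Ex_of_nat[of m] by auto
    have "\<exists>s. (\<forall>n. s n \<in> range k) \<and> s \<longlonglongrightarrow> m"
      unfolding m_def by (rule Inf_as_limit) simp
    then obtain s where range: "\<forall>n. s n \<in> range k" and lim: "s \<longlonglongrightarrow> m" by (elim exE conjE)
    have "\<forall>n. \<exists>w. s n = k w" using range by (simp add: image_iff)
    then obtain u where u: "\<And>n. s n = k (u n)" by metis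
    have "eventually (\<lambda>n. k (u n) < ereal q) sequentially"
      using order_tendstoD(2)[OF lim q] unfolding u .
    then obtain N where N: "\<And>n. n \<ge> N \<Longrightarrow> k (u n) < ereal q"
      unfolding eventually_sequentially by blast
    have "eventually (\<lambda>z. ereal (q - b) < h z) at_infinity"
      using coer unfolding coercive_def by (intro order_tendstoD(1)) auto
    then obtain \<rho> where \<rho>: "\<And>z. \<rho> \<le> norm z \<Longrightarrow> ereal (q - b) < h z"
      unfolding eventually_at_infinity by blast
    have bnd: "norm (u (n + N)) \<le> \<rho>" for n
    proof (rule ccontr)
      assume "\<not> ?thesis"
      then have "ereal (q - b) < h (u (n + N))" using \<rho> by simp
      moreover have "k (u (n + N)) < ereal q" using N by simp
      ultimately show False
        using below[of "u (n + N)"] unfolding k_def by (cases "h (u (n + N))") auto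
    qed
    then have "bounded (range (\<lambda>n. u (n + N)))" unfolding bounded_iff by auto
    then obtain z \<phi> where \<phi>: "strict_mono \<phi>" and z: "((\<lambda>n. u (n + N)) \<circ> \<phi>) \<longlonglongrightarrow> z"
      using bounded_imp_convergent_subsequence by blast
    define v where "v = (\<lambda>n. u (\<phi> n + N))"
    have vz: "v \<longlonglongrightarrow> z" using z unfolding v_def comp_def .
    have "(\<lambda>n. s (\<phi> n + N)) \<longlonglongrightarrow> m"
      using LIMSEQ_subseq_LIMSEQ[OF LIMSEQ_ignore_initial_segment[OF lim, of N] \<phi>]
      unfolding comp_def .
    then have kv: "(\<lambda>n. k (v n)) \<longlonglongrightarrow> m" unfolding v_def u .
    have "isCont c z" using cont by (simp add: continuous_on_eq_continuous_at)
    then have "(\<lambda>n. c (v n)) \<longlonglongrightarrow> c z" using vz by (rule isCont_tendsto_compose)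
    then have cv: "(\<lambda>n. ereal (- c (v n))) \<longlonglongrightarrow> ereal (- c z)"
      by (intro tendsto_ereal tendsto_minus)
    have "(\<lambda>n. k (v n) + ereal (- c (v n))) \<longlonglongrightarrow> m + ereal (- c z)"
      using kv cv by (intro tendsto_add_ereal_general) auto
    moreover have "k w + ereal (- c w) = h w" for w
      unfolding k_def by (cases "h w") auto
    ultimately have "(\<lambda>n. h (v n)) \<longlonglongrightarrow> m + ereal (- c z)" by simp
    then have "h z \<le> m + ereal (- c z)"
      using lower_semicontinuous_sequentially[OF lsc vz] by blast
    then have "k z \<le> m" unfolding k_def by (cases "h z"; cases m) auto
    then have "k z \<le> k w" for w
      unfolding m_def by (rule order_trans) (simp add: Inf_lower)
    then show ?thesis unfolding k_def by blast
  qed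
qed

text \<open>
  Expanding \<open>0 \<le> (norm (a + d) - norm a)\<^sup>2\<close> gives this upper bound for the norm near a nonzero
  point, which is where it is smooth.
\<close>

lemma norm_le_tangent_plus_quadratic:
  fixes a d :: "'a::real_inner"
  assumes "a \<noteq> 0"
  shows "norm (a + d) \<le> norm a + (a /\<^sub>R norm a) \<bullet> d + (norm d)\<^sup>2 / (2 * norm a)"
proof -
  have pos: "norm a > 0" using assms by simp
  have "0 \<le> (norm (a + d) - norm a)\<^sup>2" by simp
  also have "\<dots> = (norm (a + d))\<^sup>2 - 2 * norm a * norm (a + d) + (norm a)\<^sup>2"
    by (simp add: power2_eq_square algebra_simps)
  also have "(norm (a + d))\<^sup>2 = (norm a)\<^sup>2 + 2 * (a \<bullet> d) + (norm d)\<^sup>2"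
    by (simp add: power2_norm_eq_inner inner_simps inner_commute)
  finally have "norm (a + d) * (2 * norm a) \<le> 2 * (norm a)\<^sup>2 + 2 * (a \<bullet> d) + (norm d)\<^sup>2"
    by (simp add: algebra_simps)
  then have "norm (a + d) \<le> (2 * (norm a)\<^sup>2 + 2 * (a \<bullet> d) + (norm d)\<^sup>2) / (2 * norm a)"
    using pos by (subst pos_le_divide_eq) auto
  also have "\<dots> = norm a + (a /\<^sub>R norm a) \<bullet> d + (norm d)\<^sup>2 / (2 * norm a)"
    using pos by (simp add: field_simps power2_eq_square)
  finally show ?thesis .
qed

text \<open>
  Minimise \<open>r + K * norm (\<cdot> - y)\<close>.  At a minimiser other than \<open>y\<close> the norm is smooth, so \<open>r\<close> would
  have there a regular subgradient of norm \<open>K\<close>, which exceeds the bound.  Hence \<open>y\<close> itself is the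
  minimiser, and comparing it with \<open>u\<close> gives \<open>r y \<le> r u + K * norm (u - y)\<close>; in particular \<open>r\<close> is
  finite everywhere.  The role of \<open>f\<close> is to make the minimiser exist: \<open>f + r\<close> is coercive, and
  \<open>K * norm (\<cdot> - y) - f\<close> is bounded below because \<open>K\<close> dominates the Lipschitz constant of \<open>f\<close>.
\<close>

lemma bounded_subgradients_imp_Lipschitz:
  fixes r :: "'a::euclidean_space \<Rightarrow> ereal" and f :: "'a \<Rightarrow> real"
  assumes nm: "\<And>z. r z \<noteq> -\<infinity>" and dom: "\<exists>z. r z \<noteq> \<infinity>"
    and lsc: "lower_semicontinuous (\<lambda>z. ereal (f z) + r z)"
    and coer: "coercive (\<lambda>z. ereal (f z) + r z)"
    and f: "\<And>u v. \<bar>f u - f v\<bar> \<le> B * norm (u - v)"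
    and bound: "\<And>z v. v \<in> regular_subdiff r z \<Longrightarrow> norm v \<le> Br"
    and K: "B \<le> K" "Br < K" "0 < K"
  shows "\<exists>\<rho>. (\<forall>u. r u = ereal (\<rho> u)) \<and> (\<forall>u v. \<bar>\<rho> u - \<rho> v\<bar> \<le> K * norm (u - v))"
proof -
  have key: "r y \<le> r u + ereal (K * norm (u - y))" for y u
  proof -
    \<comment> \<open>subtracting \<open>f\<close> undoes its presence in the coercive function \<open>f + r\<close>\<close>
    define c where "c = (\<lambda>w. K * norm (w - y) - f w)"
    have "\<bar>B\<bar>-lipschitz_on UNIV f"
    proof (rule lipschitz_onI)
      fix u v :: 'a
      have "B * norm (u - v) \<le> \<bar>B\<bar> * norm (u - v)" by (intro mult_right_mono) auto
      then show "dist (f u) (f v) \<le> \<bar>B\<bar> * dist u v"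
        using f[of u v] by (simp add: dist_norm)
    qed simp
    then have "continuous_on UNIV f" by (rule lipschitz_on_continuous_on)
    then have "continuous_on UNIV c" unfolding c_def by (intro continuous_intros)
    moreover have "- f y \<le> c w" for w
    proof -
      have "B * norm (w - y) \<le> K * norm (w - y)" using K by (intro mult_right_mono) auto
      then show ?thesis using f[of w y] unfolding c_def by linarith
    qed
    ultimately obtain z where z: "\<And>w. ereal (f z) + r z + ereal (c z) \<le> ereal (f w) + r w + ereal (c w)"
      using lower_semicontinuous_coercive_attains_min[OF lsc coer] by metis
    have eq: "ereal (f w) + r w + ereal (c w) = r w + ereal (K * norm (w - y))" for w
      unfolding c_def by (cases "r w") auto
    have zmin: "r z + ereal (K * norm (z - y)) \<le> r w + ereal (K * norm (w - y))" for w
      using z[of w] unfolding eq .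
    obtain w where "r w \<noteq> \<infinity>" using dom by blast
    then obtain a where a: "r z = ereal a"
      using zmin[of w] nm[of z] nm[of w] by (cases "r z"; cases "r w") auto
    have "z = y"
    proof (rule ccontr)
      assume "z \<noteq> y"
      define e where "e = (z - y) /\<^sub>R norm (z - y)"
      have "- K *\<^sub>R e \<in> regular_subdiff r z"
      proof (rule regular_subdiffI_quadratic[where c = "K / (2 * norm (z - y))"])
        show "r z = ereal a" by (fact a)
        fix u
        have "norm (z - y + (u - z)) \<le> norm (z - y) + e \<bullet> (u - z) + (norm (u - z))\<^sup>2 / (2 * norm (z - y))"
          unfolding e_def using \<open>z \<noteq> y\<close> by (intro norm_le_tangent_plus_quadratic) auto
        then have "K * norm (u - y) \<le> K * (norm (z - y) + e \<bullet> (u - z) + (norm (u - z))\<^sup>2 / (2 * norm (z - y)))"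
          using K by (intro mult_left_mono) auto
        then show "ereal (a + (- K *\<^sub>R e) \<bullet> (u - z) - K / (2 * norm (z - y)) * (norm (u - z))\<^sup>2) \<le> r u"
          using zmin[of u] nm[of u] unfolding a by (cases "r u") (auto simp: algebra_simps)
      qed
      from bound[OF this] have "K * norm e \<le> Br" using K by simp
      moreover have "norm e = 1" unfolding e_def using \<open>z \<noteq> y\<close> by simp
      ultimately show False using K by simp
    qed
    then show ?thesis using zmin[of u] by simp
  qed
  obtain w where w: "r w \<noteq> \<infinity>" using dom by blast
  have fin: "\<bar>r u\<bar> \<noteq> \<infinity>" for u
    using key[of u w] w nm[of u] nm[of w] by (cases "r u"; cases "r w") auto
  define \<rho> where "\<rho> = (\<lambda>u. real_of_ereal (r u))"
  have \<rho>: "r u = ereal (\<rho> u)" for u unfolding \<rho>_def using fin[of u] by (simp add: ereal_real)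
  have "\<rho> u - \<rho> v \<le> K * norm (u - v)" for u v
    using key[of u v] unfolding \<rho> by (simp add: norm_minus_commute)
  then have "\<bar>\<rho> u - \<rho> v\<bar> \<le> K * norm (u - v)" for u v
    by (metis abs_le_iff minus_diff_eq norm_minus_commute)
  with \<rho> show ?thesis by blast
qed

section \<open>Functions with bounded or Lipschitz gradient\<close>

lemma GDERIV_line:
  assumes "\<And>z. GDERIV f z :> g z"
  shows "((\<lambda>t. f (u + t *\<^sub>R d)) has_real_derivative g (u + t *\<^sub>R d) \<bullet> d) (at t)"
proof -
  have "((\<lambda>t. u + t *\<^sub>R d) has_derivative (\<lambda>s. s *\<^sub>R d)) (at t)"
    by (auto intro!: derivative_eq_intros)
  moreover have "(f has_derivative (\<lambda>h. h \<bullet> g (u + t *\<^sub>R d))) (at (u + t *\<^sub>R d))"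
    using assms unfolding gderiv_def .
  ultimately have "((\<lambda>t. f (u + t *\<^sub>R d)) has_derivative (\<lambda>s. (s *\<^sub>R d) \<bullet> g (u + t *\<^sub>R d))) (at t)"
    using has_derivative_compose by fastforce
  then show ?thesis
    by (simp add: has_field_derivative_def inner_commute mult.commute mult_commute_abs)
qed

lemma bounded_gradient_imp_Lipschitz:
  assumes grad: "\<And>z. GDERIV f z :> g z" and bound: "\<And>z. norm (g z) \<le> B"
  shows "\<bar>f u - f v\<bar> \<le> B * norm (u - v)"
proof -
  obtain t where "f (v + 1 *\<^sub>R (u - v)) - f (v + 0 *\<^sub>R (u - v)) = (1 - 0) * (g (v + t *\<^sub>R (u - v)) \<bullet> (u - v))"
    using MVT2[of 0 "1::real" "\<lambda>t. f (v + t *\<^sub>R (u - v))" "\<lambda>t. g (v + t *\<^sub>R (u - v)) \<bullet> (u - v)"]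
      GDERIV_line[OF grad, of v "u - v"] by auto
  then have "\<bar>f u - f v\<bar> = \<bar>g (v + t *\<^sub>R (u - v)) \<bullet> (u - v)\<bar>" by simp
  also have "\<dots> \<le> norm (g (v + t *\<^sub>R (u - v))) * norm (u - v)" by (rule Cauchy_Schwarz_ineq2)
  also have "\<dots> \<le> B * norm (u - v)" by (intro mult_right_mono bound) auto
  finally show ?thesis .
qed

text \<open>
  On the segment from \<open>u\<close> to \<open>v\<close> the derivative of \<open>f\<close> differs from its initial value by at most
  \<open>L * t * (norm (v - u))\<^sup>2\<close>, the derivative of the quadratic bound; so \<open>f\<close> minus its linearisation
  decreases after subtracting, and increases after adding, that quadratic.
\<close>

lemma Lipschitz_gradient_quadratic_bounds:
  assumes grad: "\<And>z. GDERIV f z :> g z" and lip: "L-lipschitz_on UNIV g"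
  shows "\<bar>f v - f u - g u \<bullet> (v - u)\<bar> \<le> L / 2 * (norm (v - u))\<^sup>2"
proof -
  define d where "d = v - u"
  have L: "L \<ge> 0" using lip by (rule lipschitz_on_nonneg)
  have der: "\<bar>g (u + t *\<^sub>R d) \<bullet> d - g u \<bullet> d\<bar> \<le> L * t * (norm d)\<^sup>2" if "t \<ge> 0" for t
  proof -
    have "norm (g (u + t *\<^sub>R d) - g u) \<le> L * (t * norm d)"
      using lipschitz_onD[OF lip, of "u + t *\<^sub>R d" u] that by (simp add: dist_norm)
    then have "norm (g (u + t *\<^sub>R d) - g u) * norm d \<le> L * (t * norm d) * norm d"
      by (intro mult_right_mono) auto
    then show ?thesis
      using Cauchy_Schwarz_ineq2[of "g (u + t *\<^sub>R d) - g u" d]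
      by (simp add: inner_diff_left power2_eq_square mult.assoc)
  qed
  have up: "f (u + 1 *\<^sub>R d) - (1 * (g u \<bullet> d) + L / 2 * 1\<^sup>2 * (norm d)\<^sup>2)
      \<le> f (u + 0 *\<^sub>R d) - (0 * (g u \<bullet> d) + L / 2 * 0\<^sup>2 * (norm d)\<^sup>2)"
  proof (rule DERIV_nonpos_imp_nonincreasing[of 0 1 "\<lambda>t. f (u + t *\<^sub>R d) - (t * (g u \<bullet> d) + L / 2 * t\<^sup>2 * (norm d)\<^sup>2)"])
    fix t :: real assume t: "0 \<le> t" "t \<le> 1"
    have "((\<lambda>t. f (u + t *\<^sub>R d) - (t * (g u \<bullet> d) + L / 2 * t\<^sup>2 * (norm d)\<^sup>2)) has_real_derivative
      g (u + t *\<^sub>R d) \<bullet> d - (g u \<bullet> d + L * t * (norm d)\<^sup>2)) (at t)"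
      by (rule derivative_eq_intros GDERIV_line[OF grad] refl | simp)+
    then show "\<exists>y. ((\<lambda>t. f (u + t *\<^sub>R d) - (t * (g u \<bullet> d) + L / 2 * t\<^sup>2 * (norm d)\<^sup>2)) has_real_derivative y) (at t) \<and> y \<le> 0"
      using der[OF t(1)] by (intro exI conjI) auto
  qed simp
  have lo: "f (u + 1 *\<^sub>R d) - (1 * (g u \<bullet> d) - L / 2 * 1\<^sup>2 * (norm d)\<^sup>2)
      \<ge> f (u + 0 *\<^sub>R d) - (0 * (g u \<bullet> d) - L / 2 * 0\<^sup>2 * (norm d)\<^sup>2)"
  proof (rule DERIV_nonneg_imp_nondecreasing[of 0 1 "\<lambda>t. f (u + t *\<^sub>R d) - (t * (g u \<bullet> d) - L / 2 * t\<^sup>2 * (norm d)\<^sup>2)"])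
    fix t :: real assume t: "0 \<le> t" "t \<le> 1"
    have "((\<lambda>t. f (u + t *\<^sub>R d) - (t * (g u \<bullet> d) - L / 2 * t\<^sup>2 * (norm d)\<^sup>2)) has_real_derivative
      g (u + t *\<^sub>R d) \<bullet> d - (g u \<bullet> d - L * t * (norm d)\<^sup>2)) (at t)"
      by (rule derivative_eq_intros GDERIV_line[OF grad] refl | simp)+
    then show "\<exists>y. ((\<lambda>t. f (u + t *\<^sub>R d) - (t * (g u \<bullet> d) - L / 2 * t\<^sup>2 * (norm d)\<^sup>2)) has_real_derivative y) (at t) \<and> y \<ge> 0"
      using der[OF t(1)] by (intro exI conjI) auto
  qed simp
  show ?thesis using up lo unfolding d_def by (intro abs_leI) (auto simp: algebra_simps)
qed

section \<open>Mixing operators\<close>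

text \<open>
  Here \<open>T\<close> stands for multiplication of a stacked iterate by the mixing matrix and \<open>J\<close> for averaging
  of its rows, which is the orthogonal projection onto the consensus subspace, the fixed space of
  \<open>T\<close>.  The two form inequalities say that \<open>I \<succeq> T \<succ> -I\<close>.
\<close>

locale mixing_operator =
  fixes T J :: "'a::euclidean_space \<Rightarrow> 'a"
  assumes linear_T: "linear T"
    and T_selfadjoint: "T u \<bullet> v = u \<bullet> T v"
    and T_le_id: "0 \<le> u \<bullet> (u - T u)"
    and T_gt_minus_id: "u \<noteq> 0 \<Longrightarrow> 0 < u \<bullet> (u + T u)"
    and linear_J: "linear J"
    and J_selfadjoint: "J u \<bullet> v = u \<bullet> J v"
    and T_J: "T (J u) = J u"
    and fixed_J: "T u = u \<Longrightarrow> J u = u"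
begin

lemmas T_simps = linear_add[OF linear_T] linear_diff[OF linear_T] linear_scale[OF linear_T]
lemmas J_simps = linear_add[OF linear_J] linear_diff[OF linear_J] linear_scale[OF linear_J]

lemma J_J: "J (J u) = J u"
  by (simp add: fixed_J T_J)

lemma J_T: "J (T u) = J u"
  by (metis J_selfadjoint T_J T_selfadjoint vector_eq_rdot)

lemma J_residual: "J (u - J u) = 0"
  by (simp add: J_simps J_J)

lemma residual_orthogonal: "(u - J u) \<bullet> J v = 0"
  by (metis J_residual J_selfadjoint inner_zero_left)

lemma norm_pythagoras: "(norm u)\<^sup>2 = (norm (J u))\<^sup>2 + (norm (u - J u))\<^sup>2"
  using residual_orthogonal[of u u]
  by (simp add: power2_norm_eq_inner inner_simps inner_commute)

lemma norm_J_le: "norm (J u) \<le> norm u"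
  by (rule power2_le_imp_le) (use norm_pythagoras[of u] in auto)

lemma norm_residual_le: "norm (u - J u) \<le> norm u"
  by (rule power2_le_imp_le) (use norm_pythagoras[of u] in auto)

text \<open>
  The commuting product \<open>2 (I - T) (I + T)\<close> is the sum of the congruences \<open>(I - T) (I + T) (I - T)\<close>
  and \<open>(I + T) (I - T) (I + T)\<close>, each of which inherits its sign from its middle factor.
\<close>

lemma norm_T_defect:
  "2 * ((norm u)\<^sup>2 - (norm (T u))\<^sup>2) =
     (u - T u) \<bullet> ((u - T u) + T (u - T u)) + (u + T u) \<bullet> ((u + T u) - T (u + T u))"
  unfolding linear_diff[OF linear_T] linear_add[OF linear_T] power2_norm_eq_inner
    inner_diff_left inner_diff_right inner_add_left inner_add_right
    T_selfadjoint[of u] T_selfadjoint[of "T u"]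
  by simp

lemma norm_T_le: "norm (T u) \<le> norm u"
proof -
  have "0 \<le> (u - T u) \<bullet> ((u - T u) + T (u - T u))"
    using T_gt_minus_id[of "u - T u"] by (cases "u - T u = 0") auto
  then have "0 \<le> 2 * ((norm u)\<^sup>2 - (norm (T u))\<^sup>2)"
    unfolding norm_T_defect by (rule add_nonneg_nonneg[OF _ T_le_id])
  then have "(norm (T u))\<^sup>2 \<le> (norm u)\<^sup>2" by simp
  then show ?thesis by (rule power2_le_imp_le) simp
qed

lemma norm_T_less: "J u = 0 \<Longrightarrow> u \<noteq> 0 \<Longrightarrow> norm (T u) < norm u"
proof -
  assume u: "J u = 0" "u \<noteq> 0"
  then have "u - T u \<noteq> 0" using fixed_J[of u] by auto
  then have "0 < (u - T u) \<bullet> ((u - T u) + T (u - T u))" by (rule T_gt_minus_id)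
  then have "0 < 2 * ((norm u)\<^sup>2 - (norm (T u))\<^sup>2)"
    unfolding norm_T_defect by (rule add_pos_nonneg[OF _ T_le_id])
  then have "(norm (T u))\<^sup>2 < (norm u)\<^sup>2" by simp
  then show ?thesis by (rule power2_less_imp_less) simp
qed

text \<open>
  Off the consensus subspace \<open>T\<close> strictly decreases norms, so the maximum of \<open>norm (T u)\<close> over the
  compact unit sphere of the kernel of \<open>J\<close> is a contraction factor.
\<close>

lemma contraction:
  obtains \<zeta> where "0 \<le> \<zeta>" "\<zeta> < 1" "\<And>u. norm (T (u - J u)) \<le> \<zeta> * norm (u - J u)"
proof -
  define S where "S = sphere 0 1 \<inter> {u. J u = 0}"
  have "closed {u. J u = 0}"
    using linear_J by (intro closed_Collect_eq continuous_on_const linear_continuous_on)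
      (simp add: linear_conv_bounded_linear)
  then have "compact S" unfolding S_def by (intro compact_Int_closed) auto
  have cont: "continuous_on S (\<lambda>u. norm (T u))"
    using linear_T by (intro continuous_on_norm linear_continuous_on)
      (simp add: linear_conv_bounded_linear)
  have "\<exists>\<zeta>. 0 \<le> \<zeta> \<and> \<zeta> < 1 \<and> (\<forall>u\<in>S. norm (T u) \<le> \<zeta>)"
  proof (cases "S = {}")
    case True
    then show ?thesis by (intro exI[of _ 0]) auto
  next
    case False
    obtain w where w: "w \<in> S" "\<And>u. u \<in> S \<Longrightarrow> norm (T u) \<le> norm (T w)"
      using continuous_attains_sup[OF \<open>compact S\<close> False cont] by blast
    then have "norm (T w) < 1" using norm_T_less[of w] unfolding S_def by force
    then show ?thesis using w by (intro exI[of _ "norm (T w)"]) auto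
  qed
  then obtain \<zeta> where \<zeta>: "0 \<le> \<zeta>" "\<zeta> < 1" "\<And>u. u \<in> S \<Longrightarrow> norm (T u) \<le> \<zeta>" by blast
  have "norm (T (u - J u)) \<le> \<zeta> * norm (u - J u)" for u
  proof (cases "u - J u = 0")
    case True
    then show ?thesis by (simp only: True linear_0[OF linear_T]) simp
  next
    case False
    define d where "d = u - J u"
    have d: "norm d > 0" "J d = 0" using False J_residual[of u] unfolding d_def by auto
    then have "(1 / norm d) *\<^sub>R d \<in> S" unfolding S_def by (simp add: J_simps)
    from \<zeta>(3)[OF this] have "norm (T d) / norm d \<le> \<zeta>" using d by (simp add: T_simps)
    then show ?thesis using d unfolding d_def[symmetric] by (simp add: pos_divide_le_eq)
  qed
  then show ?thesis using that \<zeta> by blast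
qed

text \<open>
  The consensus part of \<open>u\<close> lies in the kernel of the selfadjoint operator \<open>I - T\<close>, so the penalty
  measures the deviation from consensus alone.
\<close>

lemma quadratic_form_residual:
  "u \<bullet> (u - T u) = (u - J u) \<bullet> ((u - J u) - T (u - J u))"
  unfolding linear_diff[OF linear_T] T_J inner_diff_left inner_diff_right
    J_selfadjoint[of u] J_J J_T by simp

lemma quadratic_form_le: "u \<bullet> (u - T u) \<le> 2 * (norm (u - J u))\<^sup>2"
proof -
  define d where "d = u - J u"
  have "- (d \<bullet> T d) \<le> norm d * norm (T d)"
    using Cauchy_Schwarz_ineq2[of d "T d"] by linarith
  also have "\<dots> \<le> norm d * norm d" by (intro mult_left_mono norm_T_le) auto
  finally have "d \<bullet> (d - T d) \<le> 2 * (norm d)\<^sup>2"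
    by (simp add: inner_diff_right dot_square_norm power2_eq_square)
  then show ?thesis
    unfolding quadratic_form_residual[of u] d_def .
qed

lemma norm_T_diff_le: "norm (T u - u) \<le> 2 * norm (u - J u)"
proof -
  have "T u - u = T (u - J u) - (u - J u)" by (simp add: T_simps T_J)
  then have "norm (T u - u) \<le> norm (T (u - J u)) + norm (u - J u)"
    by (metis norm_triangle_ineq4)
  then show ?thesis using norm_T_le[of "u - J u"] by linarith
qed

end

section \<open>The smallest eigenvalue and mixing matrices\<close>

lemma matrix_mult_row: "(A ** X) $ i = (\<Sum>k\<in>UNIV. A $ i $ k *\<^sub>R X $ k)"
  for A :: "real^'n^'m" and X :: "real^'p^'n"
  by (simp add: vec_eq_iff matrix_matrix_mult_def)

lemma linear_matrix_mult: "linear (\<lambda>X. A ** X)" for A :: "real^'n^'m"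
  by (rule linearI)
    (simp_all add: vec_eq_iff matrix_matrix_mult_def algebra_simps sum.distrib sum_distrib_left)

lemma column_matrix_mult: "column j (A ** X) = A *v column j X"
  for A :: "real^'n^'m" and X :: "real^'p^'n"
  by (simp add: vec_eq_iff matrix_matrix_mult_def matrix_vector_mult_def column_def)

lemma inner_eq_sum_columns: "X \<bullet> Y = (\<Sum>j\<in>UNIV. column j X \<bullet> column j Y)"
  for X Y :: "real^'p^'n"
  unfolding inner_vec_def column_def inner_real_def vec_lambda_beta by (rule sum.swap)

lemma symmetric_matrix_selfadjoint: "transpose A = A \<Longrightarrow> (A *v u) \<bullet> v = u \<bullet> (A *v v)"
  for A :: "real^'n^'n"
  by (metis dot_lmul_matrix transpose_matrix_vector)

lemma symmetric_matrix_mult_selfadjoint: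
  fixes A :: "real^'n^'n" and X Y :: "real^'p^'n"
  assumes "transpose A = A"
  shows "(A ** X) \<bullet> Y = X \<bullet> (A ** Y)"
  unfolding inner_eq_sum_columns column_matrix_mult symmetric_matrix_selfadjoint[OF assms] ..

text \<open>
  Eigenvectors for distinct eigenvalues of a symmetric matrix are orthogonal.  Finiteness is what
  makes the minimum in the definition of the smallest eigenvalue a lower bound of all eigenvalues.
\<close>

lemma finite_eigenvalues:
  fixes A :: "real^'n^'n"
  assumes sym: "transpose A = A"
  shows "finite {l. \<exists>v. v \<noteq> 0 \<and> A *v v = l *\<^sub>R v}" (is "finite ?E")
proof -
  define e where "e = (\<lambda>l. SOME v. v \<noteq> 0 \<and> A *v v = l *\<^sub>R v)"
  have e: "e l \<noteq> 0" "A *v e l = l *\<^sub>R e l" if "l \<in> ?E" for l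
    using someI_ex[of "\<lambda>v. v \<noteq> 0 \<and> A *v v = l *\<^sub>R v"] that unfolding e_def by auto
  have orth: "e l \<bullet> e l' = 0" if "l \<in> ?E" "l' \<in> ?E" "l \<noteq> l'" for l l'
  proof -
    have "(A *v e l) \<bullet> e l' = e l \<bullet> (A *v e l')" by (rule symmetric_matrix_selfadjoint[OF sym])
    then have "(l - l') * (e l \<bullet> e l') = 0"
      by (simp only: e(2)[OF that(1)] e(2)[OF that(2)]) (simp add: algebra_simps)
    then show ?thesis using that by simp
  qed
  have "inj_on e ?E"
  proof (rule inj_onI, rule ccontr)
    fix l l' assume l: "l \<in> ?E" "l' \<in> ?E" "e l = e l'" "l \<noteq> l'"
    then have "e l \<bullet> e l = 0" using orth[of l l'] by simp
    then show False using e(1)[OF l(1)] by simp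
  qed
  moreover have "pairwise orthogonal (e ` ?E)"
    using orth unfolding pairwise_def orthogonal_def by blast
  then have "finite (e ` ?E)" by (rule pairwise_orthogonal_imp_finite)
  ultimately show ?thesis by (rule finite_imageD[rotated])
qed

text \<open>
  Let \<open>m\<close> be the minimum of the form \<open>u \<bullet> A u\<close> on the unit sphere, attained at \<open>v\<close>.  Up to a factor 2
  the vector \<open>w = A v - m v\<close> is the gradient at \<open>v\<close> of the nonnegative form \<open>u \<bullet> A u - m * (norm u)\<^sup>2\<close>,
  which vanishes at \<open>v\<close>; a step along \<open>-w\<close> would make it negative unless \<open>w = 0\<close>.
\<close>

lemma Rayleigh_minimum_is_eigenvalue:
  fixes A :: "real^'n^'n"
  assumes sym: "transpose A = A"
  obtains v m where "v \<noteq> 0" "A *v v = m *\<^sub>R v" "\<And>u. m * (norm u)\<^sup>2 \<le> u \<bullet> (A *v u)"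
proof -
  have ne: "sphere (0 :: real^'n) 1 \<noteq> {}" by auto
  have "continuous_on (sphere 0 1) (\<lambda>u. u \<bullet> (A *v u))"
    by (intro continuous_intros matrix_vector_mult_linear_continuous_on)
  then obtain v where v: "v \<in> sphere 0 1"
      "\<And>u. u \<in> sphere 0 1 \<Longrightarrow> v \<bullet> (A *v v) \<le> u \<bullet> (A *v u)"
    using continuous_attains_inf[OF compact_sphere ne] by blast
  define m where "m = v \<bullet> (A *v v)"
  have min: "m * (norm u)\<^sup>2 \<le> u \<bullet> (A *v u)" for u
  proof (cases "u = 0")
    case False
    have "(1 / norm u) *\<^sub>R u \<in> sphere 0 1" using False by simp
    from v(2)[OF this] have "m \<le> (u \<bullet> (A *v u)) / (norm u)\<^sup>2"
      unfolding m_def by (simp add: matrix_vector_mult_scaleR power2_eq_square)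
    then show ?thesis using False by (simp add: pos_le_divide_eq)
  qed simp
  define w where "w = A *v v - m *\<^sub>R v"
  define q where "q = w \<bullet> (A *v w) - m * (norm w)\<^sup>2"
  \<comment> \<open>the optimal step along \<open>w\<close>, with \<open>q + 1\<close> for \<open>q\<close> to keep the denominator positive\<close>
  define t where "t = - (norm w)\<^sup>2 / (q + 1)"
  have q: "q \<ge> 0" using min[of w] unfolding q_def by simp
  have vv: "v \<bullet> v = 1" using v(1) by (simp add: norm_eq_sqrt_inner)
  have ww: "w \<bullet> (A *v v) - m * (w \<bullet> v) = (norm w)\<^sup>2"
    unfolding w_def by (simp add: power2_norm_eq_inner inner_simps algebra_simps)
  have "m * (norm (v + t *\<^sub>R w))\<^sup>2 \<le> (v + t *\<^sub>R w) \<bullet> (A *v (v + t *\<^sub>R w))" by (rule min)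
  moreover have "(v + t *\<^sub>R w) \<bullet> (A *v (v + t *\<^sub>R w)) = m + 2 * t * (w \<bullet> (A *v v)) + t\<^sup>2 * (w \<bullet> (A *v w))"
    using symmetric_matrix_selfadjoint[OF sym, of v w] inner_commute[of w v] inner_commute[of "A *v v" w]
    by (simp add: m_def matrix_vector_right_distrib matrix_vector_mult_scaleR inner_simps
        power2_eq_square algebra_simps)
  moreover have "m * (norm (v + t *\<^sub>R w))\<^sup>2 = m + 2 * t * (m * (w \<bullet> v)) + t\<^sup>2 * (m * (norm w)\<^sup>2)"
    unfolding power2_norm_eq_inner using vv inner_commute[of w v]
    by (simp add: inner_simps power2_eq_square algebra_simps)
  ultimately have "0 \<le> 2 * t * (w \<bullet> (A *v v) - m * (w \<bullet> v)) + t\<^sup>2 * q"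
    unfolding q_def by (simp add: algebra_simps)
  then have "0 \<le> 2 * t * (norm w)\<^sup>2 + t\<^sup>2 * q" unfolding ww .
  then have "0 \<le> (2 * t * (norm w)\<^sup>2 + t\<^sup>2 * q) * (q + 1)\<^sup>2" using q by simp
  also have "\<dots> = 2 * (t * (q + 1)) * (norm w)\<^sup>2 * (q + 1) + (t * (q + 1))\<^sup>2 * q"
    by (simp add: power2_eq_square algebra_simps)
  also have "t * (q + 1) = - (norm w)\<^sup>2" using q unfolding t_def by simp
  finally have "(norm w)^4 * (q + 2) \<le> 0" by (simp add: power2_eq_square power4_eq_xxxx algebra_simps)
  then have "w = 0" using q by (simp add: mult_le_0_iff)
  then have "A *v v = m *\<^sub>R v" unfolding w_def by simp
  moreover have "v \<noteq> 0" using vv by auto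
  ultimately show ?thesis using that min by blast
qed

lemma min_eigenvalue_eigenvector:
  fixes A :: "real^'n^'n"
  assumes "transpose A = A"
  obtains v where "v \<noteq> 0" "A *v v = min_eigenvalue A *\<^sub>R v"
proof -
  obtain v m where "v \<noteq> 0" "A *v v = m *\<^sub>R v" by (rule Rayleigh_minimum_is_eigenvalue[OF assms])
  then have "{l. \<exists>v. v \<noteq> 0 \<and> A *v v = l *\<^sub>R v} \<noteq> {}" by blast
  from Min_in[OF finite_eigenvalues[OF assms] this] show ?thesis
    using that unfolding min_eigenvalue_def by blast
qed

lemma min_eigenvalue_le_Rayleigh:
  fixes A :: "real^'n^'n"
  assumes "transpose A = A"
  shows "min_eigenvalue A * (norm u)\<^sup>2 \<le> u \<bullet> (A *v u)"
proof -
  obtain v m where vm: "v \<noteq> 0" "A *v v = m *\<^sub>R v" "\<And>u. m * (norm u)\<^sup>2 \<le> u \<bullet> (A *v u)"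
    by (rule Rayleigh_minimum_is_eigenvalue[OF assms]) blast
  then have "min_eigenvalue A \<le> m"
    unfolding min_eigenvalue_def by (intro Min_le finite_eigenvalues[OF assms]) blast
  then have "min_eigenvalue A * (norm u)\<^sup>2 \<le> m * (norm u)\<^sup>2" by (intro mult_right_mono) auto
  with vm(3)[of u] show ?thesis by linarith
qed

lemma min_eigenvalue_le_Rayleigh_matrix:
  fixes A :: "real^'n^'n" and X :: "real^'p^'n"
  assumes "transpose A = A"
  shows "min_eigenvalue A * (norm X)\<^sup>2 \<le> X \<bullet> (A ** X)"
  using sum_mono[OF min_eigenvalue_le_Rayleigh[OF assms], of "\<lambda>j. column j X" UNIV]
  unfolding power2_norm_eq_inner inner_eq_sum_columns[of X] column_matrix_mult sum_distrib_left .

lemma row_average_row: "row_average X $ i = (1 / real CARD('n)) *\<^sub>R (\<Sum>k\<in>UNIV. X $ k)"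
  for X :: "real^'p^'n"
  by (simp add: row_average_def matrix_mult_row)

lemma row_average_consensus:
  fixes X :: "real^'p^'n"
  assumes "\<And>i. X $ i = z"
  shows "row_average X = X"
  by (simp add: vec_eq_iff[of "row_average X"] row_average_row assms sum_constant_scaleR del: sum_constant)

context
  fixes E :: "('n::finite \<times> 'n) set" and W :: "real^'n^'n"
  assumes mixing: "mixing_matrix E W"
begin

lemma mixing_matrix_symmetric: "transpose W = W"
proof -
  have "W = transpose W" using mixing unfolding mixing_matrix_def by blast
  then show ?thesis by (rule sym)
qed

lemma mixing_matrix_pos_def: "v \<noteq> 0 \<Longrightarrow> 0 < v \<bullet> (v + W *v v)"
proof -
  assume "v \<noteq> 0"
  then have "0 < v \<bullet> ((W - (- mat 1)) *v v)"
    using mixing unfolding mixing_matrix_def pos_def_def by blast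
  also have "(W - (- mat 1)) *v v = v + W *v v"
    unfolding diff_minus_eq_add matrix_vector_mult_add_rdistrib by simp
  finally show ?thesis .
qed

lemma mixing_matrix_pos_semidef: "0 \<le> v \<bullet> (v - W *v v)"
proof -
  have "0 \<le> v \<bullet> ((mat 1 - W) *v v)"
    using mixing unfolding mixing_matrix_def pos_semidef_def by blast
  also have "(mat 1 - W) *v v = v - W *v v"
    unfolding matrix_vector_mult_diff_rdistrib by simp
  finally show ?thesis .
qed

lemma mixing_matrix_min_eigenvalue: "- 1 < min_eigenvalue W"
proof -
  obtain v where v: "v \<noteq> 0" "W *v v = min_eigenvalue W *\<^sub>R v"
    by (rule min_eigenvalue_eigenvector[OF mixing_matrix_symmetric])
  have "0 < v \<bullet> (v + W *v v)" by (rule mixing_matrix_pos_def) (fact v)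
  also have "\<dots> = (min_eigenvalue W + 1) * (v \<bullet> v)"
    unfolding v(2) by (simp add: inner_add_right algebra_simps)
  finally show ?thesis using inner_ge_zero[of v] by (auto simp: zero_less_mult_iff)
qed

lemma mixing_matrix_fixed_iff: "W *v v = v \<longleftrightarrow> v \<in> span {1}"
proof -
  have "{v. (mat 1 - W) *v v = 0} = span {1}"
    using mixing unfolding mixing_matrix_def by blast
  then have "v \<in> span {1} \<longleftrightarrow> (mat 1 - W) *v v = 0" by blast
  also have "\<dots> \<longleftrightarrow> v - W *v v = 0"
    unfolding matrix_vector_mult_diff_rdistrib by simp
  finally show ?thesis by (metis right_minus_eq)
qed

lemma mixing_matrix_operator:
  "mixing_operator (\<lambda>X :: real^'p^'n. W ** X) row_average"
proof (rule mixing_operator.intro)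
  show "linear (\<lambda>X :: real^'p^'n. W ** X)" by (rule linear_matrix_mult)
  show "linear (row_average :: real^'p^'n \<Rightarrow> _)"
    unfolding row_average_def by (intro linear_compose_scale_right linear_matrix_mult)
  fix X Y :: "real^'p^'n"
  show "(W ** X) \<bullet> Y = X \<bullet> (W ** Y)"
    by (rule symmetric_matrix_mult_selfadjoint[OF mixing_matrix_symmetric])
  show "row_average X \<bullet> Y = X \<bullet> row_average Y"
    unfolding row_average_def using symmetric_matrix_mult_selfadjoint[of "\<chi> i j. 1" X Y]
    by (simp add: transpose_def)
  have cdiff: "column j (X - W ** X) = column j X - W *v column j X" for j
    unfolding column_matrix_mult[symmetric] by (simp add: vec_eq_iff column_def)
  have cadd: "column j (X + W ** X) = column j X + W *v column j X" for j
    unfolding column_matrix_mult[symmetric] by (simp add: vec_eq_iff column_def)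
  have nonneg: "0 \<le> v \<bullet> (v + W *v v)" for v
    using mixing_matrix_pos_def[of v] by (cases "v = 0") auto
  show "0 \<le> X \<bullet> (X - W ** X)"
    unfolding inner_eq_sum_columns[of X "X - W ** X"] inner_eq_sum_columns[of X "X + W ** X"] cdiff by (intro sum_nonneg mixing_matrix_pos_semidef)
  show "0 < X \<bullet> (X + W ** X)" if nz: "X \<noteq> 0"
  proof -
    obtain i j where "X $ i $ j \<noteq> 0" using nz by (auto simp: vec_eq_iff)
    then have "column j X \<noteq> 0" unfolding vec_eq_iff column_def by auto
    then show ?thesis
      unfolding inner_eq_sum_columns[of X "X - W ** X"] inner_eq_sum_columns[of X "X + W ** X"] cadd
      using nonneg mixing_matrix_pos_def by (intro sum_pos2[of UNIV j]) auto
  qed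
  have W1: "W *v 1 = 1" unfolding mixing_matrix_fixed_iff by (simp add: span_base)
  have "(\<Sum>k\<in>UNIV. W $ i $ k) = 1" for i
    using arg_cong[OF W1, of "\<lambda>v. v $ i"] by (simp add: matrix_vector_mult_def)
  then show "W ** row_average X = row_average X"
    unfolding vec_eq_iff[of "W ** row_average X"] matrix_mult_row row_average_row
      scaleR_sum_left[symmetric] by simp
  show "row_average X = X" if fixed: "W ** X = X"
  proof -
    have eq: "X $ i = X $ k" for i k
    proof -
      have "X $ i $ j = X $ k $ j" for j
      proof -
        have "W *v column j X = column j X"
          unfolding column_matrix_mult[symmetric] fixed ..
        then obtain c where "column j X = c *\<^sub>R 1"
          unfolding mixing_matrix_fixed_iff span_singleton by blast
        then show ?thesis by (simp add: vec_eq_iff column_def)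
      qed
      then show ?thesis by (simp add: vec_eq_iff)
    qed
    show ?thesis by (rule row_average_consensus) (rule eq)
  qed
qed

end

section \<open>Scalar recursions\<close>

text \<open>
  Since \<open>a\<close> asymptotically loses no constant factor per step, from some index on \<open>a (Suc k)\<close> is at
  least \<open>(1 + \<zeta>) / 2 * a k\<close>, a factor halfway between \<open>\<zeta>\<close> and 1.  A bound \<open>d k \<le> C * a k\<close> is then
  inherited by the next index once \<open>C\<close> is large enough for the gap between \<open>\<zeta>\<close> and that factor to
  absorb the perturbation.
\<close>

lemma perturbed_contraction:
  fixes d a :: "nat \<Rightarrow> real"
  assumes rec: "\<And>k. d (Suc k) \<le> \<zeta> * d k + B * a k"
    and \<zeta>: "0 \<le> \<zeta>" "\<zeta> < 1" and B: "0 \<le> B" and a: "\<And>k. 0 < a k"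
    and ratio: "(\<lambda>k. a k / a (Suc k)) \<longlonglongrightarrow> 1"
  obtains C where "0 \<le> C" "\<And>k. d k \<le> C * a k"
proof -
  have "1 < 2 / (1 + \<zeta>)" using \<zeta> by (simp add: field_simps)
  from order_tendstoD(2)[OF ratio this]
  obtain N where N: "\<And>k. k \<ge> N \<Longrightarrow> a k / a (Suc k) < 2 / (1 + \<zeta>)"
    unfolding eventually_sequentially by blast
  have ratio': "(1 + \<zeta>) / 2 * a k \<le> a (Suc k)" if "k \<ge> N" for k
    using N[OF that] a[of k] a[of "Suc k"] \<zeta> by (simp add: field_simps)
  \<comment> \<open>the first entry lets the induction step absorb \<open>B\<close>, the others settle the finitely many initial indices\<close>
  define C where "C = Max (insert (2 * B / (1 - \<zeta>)) ((\<lambda>k. d k / a k) ` {..N}))"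
  have C_B: "2 * B / (1 - \<zeta>) \<le> C" unfolding C_def by (intro Max_ge) auto
  have C_init: "d k \<le> C * a k" if "k \<le> N" for k
  proof -
    have "d k / a k \<le> C" unfolding C_def using that by (intro Max_ge) auto
    then show ?thesis using a[of k] by (simp add: field_simps)
  qed
  have "0 \<le> 2 * B / (1 - \<zeta>)" using B \<zeta> by simp
  then have C0: "0 \<le> C" using C_B by linarith
  have B_C: "B \<le> C * (1 - \<zeta>) / 2" using C_B \<zeta> by (simp add: field_simps)
  have "d k \<le> C * a k" for k
  proof (cases "k \<le> N")
    case False
    then have "N \<le> k" by simp
    then show ?thesis
    proof (induction k rule: dec_induct)
      case base
      show ?case by (simp add: C_init)
    next
      case (step k)
      have "d (Suc k) \<le> \<zeta> * d k + B * a k" by (rule rec)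
      also have "\<dots> \<le> \<zeta> * (C * a k) + C * (1 - \<zeta>) / 2 * a k"
        using step.IH \<zeta> a[of k] B_C by (intro add_mono mult_left_mono mult_right_mono) auto
      also have "\<dots> = C * ((1 + \<zeta>) / 2 * a k)" by (simp add: field_simps)
      also have "\<dots> \<le> C * a (Suc k)" using ratio'[of k] step.hyps C0 by (intro mult_left_mono) auto
      finally show ?case .
    qed
  qed (rule C_init)
  then show ?thesis using that C0 by blast
qed

lemma quasi_descent:
  fixes a b :: "nat \<Rightarrow> real"
  assumes descent: "\<And>k. a (Suc k) \<le> a k - b k"
    and nonneg: "eventually (\<lambda>k. 0 \<le> b k) sequentially" and below: "\<And>k. m \<le> a k"
  shows "convergent a" "summable b"
proof -
  obtain N where N: "\<And>k. k \<ge> N \<Longrightarrow> 0 \<le> b k"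
    using nonneg unfolding eventually_sequentially by blast
  have "decseq (\<lambda>k. a (k + N))"
  proof (rule decseq_SucI)
    fix k show "a (Suc k + N) \<le> a (k + N)" using descent[of "k + N"] N[of "k + N"] by simp
  qed
  then have "convergent (\<lambda>k. a (k + N))"
    by (rule decseq_convergent[of _ m]) (use below in \<open>auto simp: convergent_def\<close>)
  then show "convergent a" by (rule convergent_ignore_initial_segment[THEN iffD1])
  have "(\<Sum>i<n. b (i + N)) \<le> a N - m" for n
  proof -
    have "(\<Sum>i<n. b (i + N)) \<le> (\<Sum>i<n. a (i + N) - a (Suc i + N))"
      using descent by (intro sum_mono) (simp add: algebra_simps)
    also have "\<dots> = a N - a (n + N)" using sum_lessThan_telescope'[of "\<lambda>i. a (i + N)" n] by simp
    finally show ?thesis using below[of "n + N"] by linarith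
  qed
  then have "summable (\<lambda>i. b (i + N))"
    using N by (intro summableI_nonneg_bounded) auto
  then show "summable b" by (simp add: summable_iff_shift)
qed

text \<open>
  The factorisation of \<open>u ^ 3 - v ^ 3\<close> bounds the increments of \<open>h ^ 3\<close> by multiples of
  \<open>a k * ((h k)\<^sup>2 + (h (Suc k))\<^sup>2)\<close>.  These are summable, so \<open>h ^ 3\<close> and with it \<open>h\<close> converges; a positive limit
  would make \<open>a\<close> itself summable.
\<close>

lemma slowly_varying_square_summable_tendsto_0:
  fixes h a :: "nat \<Rightarrow> real"
  assumes h: "\<And>k. 0 \<le> h k" and a: "\<And>k. 0 < a k"
    and var: "\<And>k. k \<ge> N \<Longrightarrow> \<bar>h (Suc k) - h k\<bar> \<le> C * a k"
    and double: "\<And>k. k \<ge> N \<Longrightarrow> a k \<le> 2 * a (Suc k)"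
    and sq: "summable (\<lambda>k. a k * (h k)\<^sup>2)" and div: "\<not> summable a"
  shows "h \<longlonglongrightarrow> 0"
proof -
  have C: "0 \<le> C"
    using var[of N] a[of N] by (smt (verit) mult_less_0_iff order_refl)
  have cube: "\<bar>u ^ 3 - v ^ 3\<bar> \<le> \<bar>u - v\<bar> * (2 * (u\<^sup>2 + v\<^sup>2))" if "0 \<le> u" "0 \<le> v" for u v :: real
  proof -
    have "u ^ 3 - v ^ 3 = (u - v) * (u\<^sup>2 + u * v + v\<^sup>2)"
      by (simp add: power2_eq_square power3_eq_cube algebra_simps)
    moreover have "u * v \<le> u\<^sup>2 + v\<^sup>2"
      using zero_le_power2[of "u - v"] mult_nonneg_nonneg[OF that] unfolding power2_diff by linarith
    moreover have "0 \<le> u * v" using that by simp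
    ultimately have "\<bar>u ^ 3 - v ^ 3\<bar> = \<bar>u - v\<bar> * (u\<^sup>2 + u * v + v\<^sup>2)"
        "u\<^sup>2 + u * v + v\<^sup>2 \<le> 2 * (u\<^sup>2 + v\<^sup>2)"
      by (simp_all add: abs_mult)
    then show ?thesis by (simp add: mult_left_mono)
  qed
  define e where "e = (\<lambda>k. 2 * C * (a k * (h k)\<^sup>2) + 4 * C * (a (Suc k) * (h (Suc k))\<^sup>2))"
  have "summable e"
    unfolding e_def using sq summable_Suc_iff[of "\<lambda>k. a k * (h k)\<^sup>2"] by (intro summable_add summable_mult) auto
  moreover have "eventually (\<lambda>k. norm (h (Suc k) ^ 3 - h k ^ 3) \<le> e k) sequentially"
    unfolding eventually_sequentially
  proof (intro exI[of _ N] allI impI)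
    fix k assume k: "N \<le> k"
    have "norm (h (Suc k) ^ 3 - h k ^ 3) \<le> \<bar>h (Suc k) - h k\<bar> * (2 * ((h (Suc k))\<^sup>2 + (h k)\<^sup>2))"
      using cube h by simp
    also have "\<dots> \<le> C * a k * (2 * ((h (Suc k))\<^sup>2 + (h k)\<^sup>2))"
      using var[OF k] by (intro mult_right_mono) auto
    also have "\<dots> = 2 * C * (a k * (h k)\<^sup>2) + 2 * C * (a k * (h (Suc k))\<^sup>2)"
      by (simp add: algebra_simps)
    also have "\<dots> \<le> 2 * C * (a k * (h k)\<^sup>2) + 2 * C * (2 * a (Suc k) * (h (Suc k))\<^sup>2)"
      using C double[OF k] by (intro add_left_mono mult_left_mono mult_right_mono) auto
    finally show "norm (h (Suc k) ^ 3 - h k ^ 3) \<le> e k" unfolding e_def by simp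
  qed
  ultimately have "summable (\<lambda>k. h (Suc k) ^ 3 - h k ^ 3)"
    by (rule summable_comparison_test_ev[rotated])
  then have "convergent (\<lambda>n. \<Sum>k<n. h (Suc k) ^ 3 - h k ^ 3)"
    by (simp add: summable_iff_convergent)
  moreover have "(\<Sum>k<n. h (Suc k) ^ 3 - h k ^ 3) = h n ^ 3 - h 0 ^ 3" for n
    by (rule sum_lessThan_telescope)
  ultimately have "convergent (\<lambda>n. h n ^ 3)"
    using convergent_add[of "\<lambda>n. h n ^ 3 - h 0 ^ 3" "\<lambda>_. h 0 ^ 3"] by (simp add: convergent_const)
  then obtain c where "(\<lambda>n. h n ^ 3) \<longlonglongrightarrow> c" unfolding convergent_def by blast
  then have "(\<lambda>n. root 3 (h n ^ 3)) \<longlonglongrightarrow> root 3 c" by (rule tendsto_real_root)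
  then have lim: "h \<longlonglongrightarrow> root 3 c" using h by (simp add: real_root_power_cancel)
  define l where "l = root 3 c"
  have "l \<ge> 0" using lim h unfolding l_def by (intro LIMSEQ_le_const) auto
  moreover have "\<not> l > 0"
  proof
    assume l: "l > 0"
    then have "eventually (\<lambda>k. l / 2 < h k) sequentially"
      using order_tendstoD(1)[OF lim, of "l / 2"] unfolding l_def[symmetric] by simp
    then have "eventually (\<lambda>k. norm (a k) \<le> 4 / l\<^sup>2 * (a k * (h k)\<^sup>2)) sequentially"
    proof (rule eventually_mono)
      fix k assume "l / 2 < h k"
      then have "(l / 2)\<^sup>2 \<le> (h k)\<^sup>2" using l by (intro power_mono) auto
      then have "a k * (l / 2)\<^sup>2 \<le> a k * (h k)\<^sup>2" using a[of k] by (intro mult_left_mono) auto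
      then have "4 / l\<^sup>2 * (a k * (l / 2)\<^sup>2) \<le> 4 / l\<^sup>2 * (a k * (h k)\<^sup>2)"
        by (rule mult_left_mono) simp
      moreover have "4 / l\<^sup>2 * (a k * (l / 2)\<^sup>2) = norm (a k)"
        using l a[of k] by (simp add: power2_eq_square)
      ultimately show "norm (a k) \<le> 4 / l\<^sup>2 * (a k * (h k)\<^sup>2)" by simp
    qed
    then have "summable a"
      by (rule summable_comparison_test_ev) (intro summable_mult sq)
    with div show False by contradiction
  qed
  ultimately have "l = 0" by linarith
  then show ?thesis using lim unfolding l_def by simp
qed

lemma power2_norm_diff_scaleR:
  fixes u v :: "'a::real_inner"
  shows "(norm (u - a *\<^sub>R v))\<^sup>2 = (norm u)\<^sup>2 - 2 * a * (v \<bullet> u) + a\<^sup>2 * (norm v)\<^sup>2"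
  unfolding power2_norm_eq_inner
  by (simp add: inner_diff_left inner_diff_right inner_commute power2_eq_square algebra_simps)

section \<open>The decentralized proximal gradient iteration\<close>

text \<open>
  The iteration on stacked variables: \<open>F\<close> and \<open>R\<close> are the sums of the smooth and of the nonsmooth
  terms, \<open>G\<close> is the gradient of \<open>F\<close>, \<open>lam\<close> bounds the spectrum of \<open>T\<close> from below, and \<open>D\<close>, \<open>M\<close>, \<open>m\<close> are
  uniform bounds.  How \<open>\<xi>\<close> is related to \<open>R\<close> depends on whether \<open>R\<close> is convex, so each result below
  states the inequality that it rests on.
\<close>

locale prox_dgd = mixing_operator T J for T J :: "'a::euclidean_space \<Rightarrow> 'a" +
  fixes F R :: "'a \<Rightarrow> real" and G :: "'a \<Rightarrow> 'a" and Lf lam D M m :: real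
    and \<alpha> :: "nat \<Rightarrow> real" and x \<xi> :: "nat \<Rightarrow> 'a"
  assumes T_ge: "lam * (norm u)\<^sup>2 \<le> u \<bullet> T u"
    and F_quadratic: "\<bar>F v - F u - G u \<bullet> (v - u)\<bar> \<le> Lf / 2 * (norm (v - u))\<^sup>2"
    and F_Lipschitz: "\<bar>F u - F v\<bar> \<le> M * norm (u - v)"
    and R_Lipschitz: "\<bar>R u - R v\<bar> \<le> M * norm (u - v)"
    and M_nonneg: "0 \<le> M"
    and G_bound: "norm (G u) \<le> D"
    and \<xi>_bound: "norm (\<xi> (Suc k)) \<le> D"
    and bounded_below: "m \<le> F u + R u"
    and \<alpha>_pos: "0 < \<alpha> k"
    and \<alpha>_dec: "\<alpha> (Suc k) \<le> \<alpha> k"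
    and \<alpha>_lim: "\<alpha> \<longlonglongrightarrow> 0"
    and \<alpha>_ratio: "(\<lambda>k. \<alpha> k / \<alpha> (Suc k)) \<longlonglongrightarrow> 1"
    and x_step: "x (Suc k) = T (x k) - \<alpha> k *\<^sub>R (G (x k) + \<xi> (Suc k))"
begin

lemma D_nonneg: "0 \<le> D"
  using G_bound[of 0] norm_ge_zero order_trans by blast

lemma direction_bound: "norm (G (x k) + \<xi> (Suc k)) \<le> 2 * D"
  using norm_triangle_ineq[of "G (x k)" "\<xi> (Suc k)"] G_bound[of "x k"] \<xi>_bound[of k] by linarith

text \<open>
  The deviation from consensus is contracted by \<open>T\<close> and perturbed by a bounded direction of length
  \<open>\<alpha> k\<close>, so it is of the order of the step size.
\<close>

lemma consensus_error:
  obtains C where "0 \<le> C" "\<And>k. norm (x k - J (x k)) \<le> C * \<alpha> k"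
proof -
  obtain \<zeta> where \<zeta>: "0 \<le> \<zeta>" "\<zeta> < 1" "\<And>u. norm (T (u - J u)) \<le> \<zeta> * norm (u - J u)"
    by (rule contraction) blast
  show ?thesis
  proof (rule perturbed_contraction[of "\<lambda>k. norm (x k - J (x k))" \<zeta> "2 * D" \<alpha>])
    fix k
    define v where "v = G (x k) + \<xi> (Suc k)"
    have "x (Suc k) - J (x (Suc k)) = T (x k - J (x k)) - \<alpha> k *\<^sub>R (v - J v)"
      unfolding x_step v_def[symmetric] by (simp add: T_simps J_simps T_J J_T algebra_simps)
    then have "norm (x (Suc k) - J (x (Suc k))) \<le> norm (T (x k - J (x k))) + \<alpha> k * norm (v - J v)"
      using norm_triangle_ineq4[of "T (x k - J (x k))" "\<alpha> k *\<^sub>R (v - J v)"] \<alpha>_pos[of k] by simp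
    also have "\<dots> \<le> \<zeta> * norm (x k - J (x k)) + \<alpha> k * (2 * D)"
      using \<zeta>(3) \<alpha>_pos[of k] norm_residual_le[of v] direction_bound[of k]
      unfolding v_def[symmetric] by (intro add_mono mult_left_mono) auto
    finally show "norm (x (Suc k) - J (x (Suc k))) \<le> \<zeta> * norm (x k - J (x k)) + 2 * D * \<alpha> k"
      by (simp add: mult_ac)
  qed (use \<zeta> \<alpha>_pos \<alpha>_ratio D_nonneg that in auto)
qed

lemma step_length:
  obtains C where "0 \<le> C" "\<And>k. norm (x (Suc k) - x k) \<le> C * \<alpha> k"
proof -
  obtain C where C: "0 \<le> C" "\<And>k. norm (x k - J (x k)) \<le> C * \<alpha> k" by (rule consensus_error) blast
  have "norm (x (Suc k) - x k) \<le> (2 * C + 2 * D) * \<alpha> k" for k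
  proof -
    define v where "v = G (x k) + \<xi> (Suc k)"
    have "x (Suc k) - x k = (T (x k) - x k) - \<alpha> k *\<^sub>R v"
      unfolding x_step v_def[symmetric] by simp
    then have "norm (x (Suc k) - x k) \<le> norm (T (x k) - x k) + \<alpha> k * norm v"
      using norm_triangle_ineq4[of "T (x k) - x k" "\<alpha> k *\<^sub>R v"] \<alpha>_pos[of k]
      by (metis abs_of_pos norm_scaleR)
    also have "\<dots> \<le> 2 * (C * \<alpha> k) + \<alpha> k * (2 * D)"
      using norm_T_diff_le[of "x k"] C(2)[of k] direction_bound[of k] \<alpha>_pos[of k]
      unfolding v_def[symmetric] by (intro add_mono mult_left_mono) auto
    finally show ?thesis by (simp add: algebra_simps)
  qed
  moreover have "0 \<le> 2 * C + 2 * D" using C D_nonneg by simp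
  ultimately show ?thesis using that by blast
qed

lemma scaled_tendsto_0: "(\<lambda>k. C * \<alpha> k) \<longlonglongrightarrow> 0"
  using tendsto_mult_left[OF \<alpha>_lim, of C] by simp

lemma step_length_tendsto_0: "(\<lambda>k. x (Suc k) - x k) \<longlonglongrightarrow> 0"
proof -
  obtain C where C: "\<And>k. norm (x (Suc k) - x k) \<le> C * \<alpha> k" by (rule step_length) blast
  show ?thesis by (rule Lim_null_comparison[OF _ scaled_tendsto_0[of C]]) (use C in auto)
qed

lemma consensus_error_tendsto_0: "(\<lambda>k. x k - J (x k)) \<longlonglongrightarrow> 0"
proof -
  obtain C where C: "\<And>k. norm (x k - J (x k)) \<le> C * \<alpha> k" by (rule consensus_error) blast
  show ?thesis by (rule Lim_null_comparison[OF _ scaled_tendsto_0[of C]]) (use C in auto)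
qed

text \<open>
  The iteration is a proximal gradient step of length \<open>\<alpha> k\<close> for this function, whose smooth part
  has the gradient \<open>G u + (u - T u) /\<^sub>R \<alpha> k\<close>.
\<close>

definition lyap :: "nat \<Rightarrow> 'a \<Rightarrow> real" where
  "lyap k u = F u + R u + 1 / (2 * \<alpha> k) * (u \<bullet> (u - T u))"

text \<open>
  The parameter \<open>\<theta>\<close> treats two cases at once: minimality in the proximal step gives the hypothesis
  with \<open>\<theta> = 0\<close>, and the subgradient inequality of a convex \<open>R\<close> gives it with \<open>\<theta> = 1\<close>.  The rest is the
  expansion of the quadratic form and of \<open>F\<close> around \<open>x k\<close>; the first-order terms cancel because of
  the formula for \<open>x (Suc k)\<close>.
\<close>

lemma lyap_descent:
  assumes R_step: "R (x (Suc k)) \<le> R (x k) + \<xi> (Suc k) \<bullet> (x (Suc k) - x k)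
      + (1 - \<theta>) / (2 * \<alpha> k) * (norm (x (Suc k) - x k))\<^sup>2"
  shows "lyap k (x (Suc k)) \<le> lyap k (x k)
      - (inverse (\<alpha> k) * (\<theta> + lam) - Lf) * (norm (x (Suc k) - x k))\<^sup>2 / 2"
proof -
  define d where "d = x (Suc k) - x k"
  define w where "w = x k - T (x k)"
  define a where "a = \<alpha> k"
  have a: "0 < a" unfolding a_def by (rule \<alpha>_pos)
  have dstep: "d = - w - a *\<^sub>R (G (x k) + \<xi> (Suc k))"
    unfolding d_def w_def a_def x_step by simp
  have "a * (\<xi> (Suc k) \<bullet> d) = (a *\<^sub>R \<xi> (Suc k)) \<bullet> d" by simp
  also have "a *\<^sub>R \<xi> (Suc k) = - d - w - a *\<^sub>R G (x k)"
    unfolding dstep by (simp add: algebra_simps)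
  finally have \<xi>d: "a * (\<xi> (Suc k) \<bullet> d) = - (norm d)\<^sup>2 - w \<bullet> d - a * (G (x k) \<bullet> d)"
    by (simp add: inner_diff_left power2_norm_eq_inner)
  have xk: "x (Suc k) = x k + d" unfolding d_def by simp
  have Q: "x (Suc k) \<bullet> (x (Suc k) - T (x (Suc k))) = x k \<bullet> (x k - T (x k)) + 2 * (w \<bullet> d) + (norm d)\<^sup>2 - d \<bullet> T d"
    unfolding xk w_def linear_add[OF linear_T] power2_norm_eq_inner
    using T_selfadjoint[of "x k" d] inner_commute[of "x k" d] inner_commute[of d "T (x k)"]
    by (simp add: inner_add_left inner_add_right inner_diff_left inner_diff_right)
  have Fd: "F (x (Suc k)) \<le> F (x k) + G (x k) \<bullet> d + Lf / 2 * (norm d)\<^sup>2"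
    using F_quadratic[of "x (Suc k)" "x k"] unfolding d_def[symmetric] by linarith
  have Td: "lam * (norm d)\<^sup>2 \<le> d \<bullet> T d" by (rule T_ge)
  have Rd: "R (x (Suc k)) \<le> R (x k) + \<xi> (Suc k) \<bullet> d + (1 - \<theta>) / (2 * a) * (norm d)\<^sup>2"
    using R_step unfolding d_def a_def .
  have "2 * a * (lyap k (x (Suc k))) =
      2 * a * F (x (Suc k)) + 2 * a * R (x (Suc k)) + x (Suc k) \<bullet> (x (Suc k) - T (x (Suc k)))"
    unfolding lyap_def a_def[symmetric] using a by (simp add: field_simps)
  also have "\<dots> \<le> 2 * a * (F (x k) + G (x k) \<bullet> d + Lf / 2 * (norm d)\<^sup>2)
       + 2 * a * (R (x k) + \<xi> (Suc k) \<bullet> d + (1 - \<theta>) / (2 * a) * (norm d)\<^sup>2)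
       + (x k \<bullet> (x k - T (x k)) + 2 * (w \<bullet> d) + (norm d)\<^sup>2 - lam * (norm d)\<^sup>2)"
    unfolding Q using Fd Rd Td a by (intro add_mono mult_left_mono) auto
  also have "2 * a * (R (x k) + \<xi> (Suc k) \<bullet> d + (1 - \<theta>) / (2 * a) * (norm d)\<^sup>2)
      = 2 * a * R (x k) + 2 * (a * (\<xi> (Suc k) \<bullet> d)) + (1 - \<theta>) * (norm d)\<^sup>2"
    using a by (simp add: distrib_left)
  also have "2 * a * (F (x k) + G (x k) \<bullet> d + Lf / 2 * (norm d)\<^sup>2)
       + (2 * a * R (x k) + 2 * (a * (\<xi> (Suc k) \<bullet> d)) + (1 - \<theta>) * (norm d)\<^sup>2)
       + (x k \<bullet> (x k - T (x k)) + 2 * (w \<bullet> d) + (norm d)\<^sup>2 - lam * (norm d)\<^sup>2)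
     = 2 * a * (F (x k) + R (x k)) + x k \<bullet> (x k - T (x k)) - (\<theta> + lam - a * Lf) * (norm d)\<^sup>2"
    unfolding \<xi>d by (simp add: algebra_simps)
  also have "\<dots> = 2 * a * (lyap k (x k) - (inverse a * (\<theta> + lam) - Lf) * (norm d)\<^sup>2 / 2)"
    unfolding lyap_def a_def[symmetric] using a by (simp add: field_simps)
  finally show ?thesis using a unfolding a_def d_def by simp
qed

lemma coefficient_dominates:
  assumes "0 < c"
  shows "eventually (\<lambda>k. inverse (\<alpha> k) * c - Lf \<ge> inverse (\<alpha> k) * (c / 2)) sequentially"
proof -
  have "eventually (\<lambda>k. (2 * \<bar>Lf\<bar>) * \<alpha> k < c) sequentially"
    by (rule order_tendstoD(2)[OF scaled_tendsto_0]) (fact assms)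
  then show ?thesis
  proof (rule eventually_mono)
    fix k assume "2 * \<bar>Lf\<bar> * \<alpha> k < c"
    moreover have "Lf * \<alpha> k \<le> \<bar>Lf\<bar> * \<alpha> k" using \<alpha>_pos[of k] by (intro mult_right_mono) auto
    ultimately have "Lf * \<alpha> k \<le> c / 2" by linarith
    then have "Lf \<le> c / 2 / \<alpha> k" using pos_le_divide_eq[OF \<alpha>_pos[of k], of Lf "c / 2"] by blast
    moreover have "inverse (\<alpha> k) * (c / 2) = c / 2 / \<alpha> k" "inverse (\<alpha> k) * c = 2 * (c / 2 / \<alpha> k)"
      unfolding divide_inverse by (simp_all only: mult_ac) simp
    ultimately show "inverse (\<alpha> k) * c - Lf \<ge> inverse (\<alpha> k) * (c / 2)" by linarith
  qed
qed

text \<open>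
  Replacing \<open>\<alpha> k\<close> by \<open>\<alpha> (Suc k)\<close> in the penalty raises the Lyapunov value.  As the consensus error is
  at most \<open>C * \<alpha> (Suc k)\<close>, the increase is at most \<open>C\<^sup>2 * (\<alpha> k - \<alpha> (Suc k))\<close>, which telescopes: adding
  \<open>C\<^sup>2 * \<alpha> k\<close> to the Lyapunov value yields a sequence with genuine descent as soon as \<open>\<alpha> k\<close> is small.
  The same estimate of the consensus error shows that the penalty tends to zero.
\<close>

theorem lyap_convergence:
  assumes c: "0 < \<theta> + lam"
    and R_step: "\<And>k. R (x (Suc k)) \<le> R (x k) + \<xi> (Suc k) \<bullet> (x (Suc k) - x k)
      + (1 - \<theta>) / (2 * \<alpha> k) * (norm (x (Suc k) - x k))\<^sup>2"
  shows "\<exists>l. (\<lambda>k. lyap k (x k)) \<longlonglongrightarrow> l \<and> (\<lambda>k. F (x k) + R (x k)) \<longlonglongrightarrow> l"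
    and "summable (\<lambda>k. (inverse (\<alpha> k) * (\<theta> + lam) - Lf) * (norm (x (Suc k) - x k))\<^sup>2)"
proof -
  obtain C where C: "0 \<le> C" "\<And>k. norm (x k - J (x k)) \<le> C * \<alpha> k" by (rule consensus_error) blast
  have Q_nonneg: "0 \<le> u \<bullet> (u - T u)" for u by (rule T_le_id)
  have Q_le: "x k \<bullet> (x k - T (x k)) \<le> 2 * (C * \<alpha> k)\<^sup>2" for k
    using quadratic_form_le[of "x k"] power_mono[OF C(2)[of k], of 2] by simp
  define b where "b = (\<lambda>k. (inverse (\<alpha> k) * (\<theta> + lam) - Lf) * (norm (x (Suc k) - x k))\<^sup>2)"
  \<comment> \<open>the summand \<open>C\<^sup>2 * \<alpha> k\<close> absorbs the effect of changing the penalty parameter\<close>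
  define a where "a = (\<lambda>k. lyap k (x k) + C\<^sup>2 * \<alpha> k)"
  have desc: "a (Suc k) \<le> a k - b k / 2" for k
  proof -
    have "lyap (Suc k) (x (Suc k)) = lyap k (x (Suc k))
       + (1 / (2 * \<alpha> (Suc k)) - 1 / (2 * \<alpha> k)) * (x (Suc k) \<bullet> (x (Suc k) - T (x (Suc k))))"
      unfolding lyap_def by (simp add: algebra_simps)
    also have "(1 / (2 * \<alpha> (Suc k)) - 1 / (2 * \<alpha> k)) * (x (Suc k) \<bullet> (x (Suc k) - T (x (Suc k))))
       \<le> (1 / (2 * \<alpha> (Suc k)) - 1 / (2 * \<alpha> k)) * (2 * (C * \<alpha> (Suc k))\<^sup>2)"
      using Q_le \<alpha>_dec[of k] \<alpha>_pos[of "Suc k"] by (intro mult_left_mono) (auto intro: divide_left_mono)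
    also have "\<dots> = C\<^sup>2 * ((\<alpha> (Suc k) / \<alpha> k) * (\<alpha> k - \<alpha> (Suc k)))"
      using \<alpha>_pos[of k] \<alpha>_pos[of "Suc k"] by (simp add: field_simps power2_eq_square)
    also have "\<dots> \<le> C\<^sup>2 * (1 * (\<alpha> k - \<alpha> (Suc k)))"
      using \<alpha>_pos[of k] \<alpha>_dec[of k] by (intro mult_left_mono mult_right_mono) auto
    finally have "lyap (Suc k) (x (Suc k)) \<le> lyap k (x (Suc k)) + C\<^sup>2 * (\<alpha> k - \<alpha> (Suc k))" by simp
    moreover have "lyap k (x (Suc k)) \<le> lyap k (x k) - b k / 2"
      unfolding b_def by (rule lyap_descent) (rule R_step)
    ultimately show ?thesis unfolding a_def by (simp add: algebra_simps)
  qed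
  have nonneg: "eventually (\<lambda>k. 0 \<le> b k / 2) sequentially"
    using coefficient_dominates[OF c]
  proof (rule eventually_mono)
    fix k assume "inverse (\<alpha> k) * ((\<theta> + lam) / 2) \<le> inverse (\<alpha> k) * (\<theta> + lam) - Lf"
    moreover have "0 \<le> inverse (\<alpha> k) * ((\<theta> + lam) / 2)" using \<alpha>_pos[of k] c by simp
    ultimately show "0 \<le> b k / 2" unfolding b_def by simp
  qed
  have below: "m \<le> a k" for k
  proof -
    have "0 \<le> 1 / (2 * \<alpha> k) * (x k \<bullet> (x k - T (x k)))"
      using Q_nonneg[of "x k"] \<alpha>_pos[of k] by (intro mult_nonneg_nonneg) auto
    moreover have "0 \<le> C\<^sup>2 * \<alpha> k" using \<alpha>_pos[of k] by simp
    ultimately show ?thesis using bounded_below[of "x k"] unfolding a_def lyap_def by linarith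
  qed
  have "convergent a" "summable (\<lambda>k. b k / 2)"
    using quasi_descent[of a "\<lambda>k. b k / 2", OF desc nonneg below] by blast+
  from summable_mult[OF this(2), of 2]
  show "summable (\<lambda>k. (inverse (\<alpha> k) * (\<theta> + lam) - Lf) * (norm (x (Suc k) - x k))\<^sup>2)"
    unfolding b_def by simp
  obtain l where l: "a \<longlonglongrightarrow> l" using \<open>convergent a\<close> unfolding convergent_def by blast
  have lim1: "(\<lambda>k. lyap k (x k)) \<longlonglongrightarrow> l"
    using tendsto_diff[OF l scaled_tendsto_0[of "C\<^sup>2"]] unfolding a_def by simp
  have "(\<lambda>k. 1 / (2 * \<alpha> k) * (x k \<bullet> (x k - T (x k)))) \<longlonglongrightarrow> 0"
  proof (rule Lim_null_comparison[OF _ scaled_tendsto_0[of "C\<^sup>2"]], intro always_eventually allI)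
    fix k
    have "1 / (2 * \<alpha> k) * (x k \<bullet> (x k - T (x k))) \<le> 1 / (2 * \<alpha> k) * (2 * (C * \<alpha> k)\<^sup>2)"
      using \<alpha>_pos[of k] by (intro mult_left_mono Q_le) auto
    also have "\<dots> = C\<^sup>2 * \<alpha> k" using \<alpha>_pos[of k] by (simp add: power2_eq_square)
    finally show "norm (1 / (2 * \<alpha> k) * (x k \<bullet> (x k - T (x k)))) \<le> C\<^sup>2 * \<alpha> k"
      using Q_nonneg[of "x k"] \<alpha>_pos[of k] by simp
  qed
  from tendsto_diff[OF lim1 this] have "(\<lambda>k. F (x k) + R (x k)) \<longlonglongrightarrow> l" unfolding lyap_def by simp
  with lim1 show "\<exists>l. (\<lambda>k. lyap k (x k)) \<longlonglongrightarrow> l \<and> (\<lambda>k. F (x k) + R (x k)) \<longlonglongrightarrow> l" by blast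
qed

text \<open>
  As \<open>J\<close> annihilates \<open>T - I\<close>, averaging a step leaves \<open>- \<alpha> k\<close> times the averaged direction.  The
  summability of the steps therefore controls the sum of \<open>\<alpha> k\<close> times its squared norm, while the
  Lipschitz hypotheses make its increments of order \<open>\<alpha> k\<close>.
\<close>

theorem average_direction_tendsto_0:
  assumes c: "0 < c"
    and summ: "summable (\<lambda>k. (inverse (\<alpha> k) * c - Lf) * (norm (x (Suc k) - x k))\<^sup>2)"
    and G_Lipschitz: "\<And>u v. norm (G u - G v) \<le> Lf * norm (u - v)"
    and \<xi>_Lipschitz: "\<And>k. k > k0 \<Longrightarrow> norm (\<xi> (Suc k) - \<xi> k) \<le> Lr * norm (x (Suc k) - x k)"
    and Lr: "0 \<le> Lr" and Lf: "0 \<le> Lf"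
    and div: "\<not> summable \<alpha>"
  shows "(\<lambda>k. J (G (x k) + \<xi> (Suc k))) \<longlonglongrightarrow> 0"
proof -
  define v where "v = (\<lambda>k. J (G (x k) + \<xi> (Suc k)))"
  define s where "s = (\<lambda>k. (norm (x (Suc k) - x k))\<^sup>2)"
  obtain C where C: "0 \<le> C" "\<And>k. norm (x (Suc k) - x k) \<le> C * \<alpha> k" by (rule step_length) blast
  obtain N where N: "\<And>k. k \<ge> N \<Longrightarrow> \<alpha> k / \<alpha> (Suc k) < 2"
    using order_tendstoD(2)[OF \<alpha>_ratio, of 2] unfolding eventually_sequentially by auto
  have "eventually (\<lambda>k. norm (\<alpha> k * (norm (v k))\<^sup>2) \<le> 2 / c * ((inverse (\<alpha> k) * c - Lf) * s k)) sequentially"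
    using coefficient_dominates[OF c]
  proof (rule eventually_mono)
    fix k assume k: "inverse (\<alpha> k) * (c / 2) \<le> inverse (\<alpha> k) * c - Lf"
    have "J (x (Suc k) - x k) = - (\<alpha> k *\<^sub>R v k)"
      unfolding x_step v_def J_simps J_T by simp
    then have "\<alpha> k * norm (v k) \<le> norm (x (Suc k) - x k)"
      using norm_J_le[of "x (Suc k) - x k"] \<alpha>_pos[of k] by simp
    then have "(\<alpha> k * norm (v k))\<^sup>2 \<le> s k"
      unfolding s_def using \<alpha>_pos[of k] by (intro power_mono) auto
    then have "\<alpha> k * (norm (v k))\<^sup>2 \<le> inverse (\<alpha> k) * s k"
      using \<alpha>_pos[of k] by (simp add: field_simps power2_eq_square)
    also have "\<dots> = 2 / c * (inverse (\<alpha> k) * (c / 2) * s k)" using c by simp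
    also have "\<dots> \<le> 2 / c * ((inverse (\<alpha> k) * c - Lf) * s k)"
      using k c unfolding s_def by (intro mult_left_mono mult_right_mono) auto
    finally show "norm (\<alpha> k * (norm (v k))\<^sup>2) \<le> 2 / c * ((inverse (\<alpha> k) * c - Lf) * s k)"
      using \<alpha>_pos[of k] by simp
  qed
  then have sq: "summable (\<lambda>k. \<alpha> k * (norm (v k))\<^sup>2)"
    by (rule summable_comparison_test_ev) (use summ in \<open>auto simp: s_def intro: summable_mult\<close>)
  have "(\<lambda>k. norm (v k)) \<longlonglongrightarrow> 0"
  proof (rule slowly_varying_square_summable_tendsto_0[where a = \<alpha> and N = "max N k0" and C = "Lf * C + Lr * C"])
    fix k assume k: "max N k0 \<le> k"
    have "norm (v (Suc k) - v k) = norm (J ((G (x (Suc k)) - G (x k)) + (\<xi> (Suc (Suc k)) - \<xi> (Suc k))))"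
      unfolding v_def by (simp add: J_simps algebra_simps)
    also have "\<dots> \<le> norm (G (x (Suc k)) - G (x k)) + norm (\<xi> (Suc (Suc k)) - \<xi> (Suc k))"
      by (rule order_trans[OF norm_J_le norm_triangle_ineq])
    also have "\<dots> \<le> Lf * norm (x (Suc k) - x k) + Lr * norm (x (Suc (Suc k)) - x (Suc k))"
      using k by (intro add_mono G_Lipschitz \<xi>_Lipschitz) auto
    also have "\<dots> \<le> Lf * (C * \<alpha> k) + Lr * (C * \<alpha> (Suc k))"
      by (intro add_mono mult_left_mono C Lf Lr)
    also have "\<dots> \<le> Lf * (C * \<alpha> k) + Lr * (C * \<alpha> k)"
      by (intro add_left_mono mult_left_mono C Lf Lr \<alpha>_dec)
    finally show "\<bar>norm (v (Suc k)) - norm (v k)\<bar> \<le> (Lf * C + Lr * C) * \<alpha> k"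
      using norm_triangle_ineq3[of "v (Suc k)" "v k"] by (simp add: algebra_simps)
    show "\<alpha> k \<le> 2 * \<alpha> (Suc k)"
      using N[of k] k \<alpha>_pos[of "Suc k"] by (simp add: field_simps)
  qed (use \<alpha>_pos div sq in auto)
  then show ?thesis unfolding v_def by (rule tendsto_norm_zero_cancel)
qed

text \<open>
  Expand the squared distance from \<open>x (Suc k)\<close> to \<open>z\<close>, and estimate the inner product with the
  direction by convexity.  The gradient is taken at \<open>x k\<close>, the subgradient at \<open>x (Suc k)\<close>, and the
  inner product involves \<open>T (x k)\<close>; all of these points lie within \<open>O(\<alpha> k)\<close> of \<open>J (x (Suc k))\<close>, so
  exchanging them costs \<open>O((\<alpha> k)\<^sup>2)\<close>.
\<close>

theorem ergodic_step:
  assumes F_convex: "\<And>u v. F v \<ge> F u + G u \<bullet> (v - u)"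
    and R_convex: "\<And>k u. R u \<ge> R (x (Suc k)) + \<xi> (Suc k) \<bullet> (u - x (Suc k))"
    and fixed: "T z = z"
  obtains C where "0 \<le> C" "\<And>k. 2 * \<alpha> k * (F (J (x (Suc k))) + R (J (x (Suc k))) - (F z + R z))
      \<le> (norm (x k - z))\<^sup>2 - (norm (x (Suc k) - z))\<^sup>2 + C * (\<alpha> k)\<^sup>2"
proof -
  obtain C1 where C1: "0 \<le> C1" "\<And>k. norm (x k - J (x k)) \<le> C1 * \<alpha> k" by (rule consensus_error) blast
  obtain C2 where C2: "0 \<le> C2" "\<And>k. norm (x (Suc k) - x k) \<le> C2 * \<alpha> k" by (rule step_length) blast
  define C where "C = 4 * D\<^sup>2 + 2 * (D * (2 * C1) + D * (2 * D) + M * (C1 + C2) + M * C1)"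
  have C: "0 \<le> C" unfolding C_def using C1 C2 D_nonneg M_nonneg by simp
  have "2 * \<alpha> k * (F (J (x (Suc k))) + R (J (x (Suc k))) - (F z + R z))
      \<le> (norm (x k - z))\<^sup>2 - (norm (x (Suc k) - z))\<^sup>2 + C * (\<alpha> k)\<^sup>2" for k
  proof -
    define a where "a = \<alpha> k"
    define y where "y = x (Suc k)"
    define g where "g = G (x k)"
    define s where "s = \<xi> (Suc k)"
    have a: "0 < a" unfolding a_def by (rule \<alpha>_pos)
    have y: "y = T (x k) - a *\<^sub>R (g + s)" unfolding y_def a_def g_def s_def by (rule x_step)
    have gs: "norm (g + s) \<le> 2 * D" unfolding g_def s_def by (rule direction_bound)
    have consensus_y: "norm (y - J y) \<le> C1 * a"
      using C1(2)[of "Suc k"] mult_left_mono[OF \<alpha>_dec[of k] C1(1)] unfolding y_def a_def by linarith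
    have "y - z = T (x k - z) - a *\<^sub>R (g + s)" unfolding y by (simp add: T_simps fixed)
    then have "(norm (y - z))\<^sup>2 = (norm (T (x k - z)))\<^sup>2 - 2 * a * ((g + s) \<bullet> T (x k - z)) + a\<^sup>2 * (norm (g + s))\<^sup>2"
      by (simp only: power2_norm_diff_scaleR)
    moreover have "(norm (T (x k - z)))\<^sup>2 \<le> (norm (x k - z))\<^sup>2" by (intro power_mono norm_T_le) simp
    moreover have "a\<^sup>2 * (norm (g + s))\<^sup>2 \<le> a\<^sup>2 * (2 * D)\<^sup>2"
      using gs by (intro mult_left_mono power_mono) auto
    ultimately have dist: "2 * a * ((g + s) \<bullet> (T (x k) - z))
        \<le> (norm (x k - z))\<^sup>2 - (norm (y - z))\<^sup>2 + 4 * D\<^sup>2 * a\<^sup>2"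
      by (simp add: T_simps fixed algebra_simps power2_eq_square)
    have "g \<bullet> (x k - T (x k)) \<le> norm g * norm (x k - T (x k))" by (rule norm_cauchy_schwarz)
    also have "\<dots> \<le> D * (2 * (C1 * a))"
      using G_bound norm_T_diff_le[of "x k"] C1(2)[of k] D_nonneg unfolding g_def a_def
      by (intro mult_mono) (auto simp: norm_minus_commute)
    finally have g1: "g \<bullet> (x k - T (x k)) \<le> D * (2 * C1) * a" by simp
    have g2: "F (x k) - F z \<le> g \<bullet> (x k - z)"
      using F_convex[of "x k" z] unfolding g_def by (simp add: inner_diff_right)
    have g3: "F (J y) - F (x k) \<le> M * (C1 + C2) * a"
    proof -
      have "norm (J y - x k) \<le> norm (y - J y) + norm (y - x k)"
        using norm_triangle_ineq[of "J y - y" "y - x k"] by (simp add: norm_minus_commute)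
      also have "\<dots> \<le> (C1 + C2) * a"
        using consensus_y C2(2)[of k] unfolding y_def a_def distrib_right by linarith
      finally have "M * norm (J y - x k) \<le> M * ((C1 + C2) * a)"
        using M_nonneg by (rule mult_left_mono)
      then show ?thesis using F_Lipschitz[of "J y" "x k"] unfolding mult.assoc by linarith
    qed
    have "s \<bullet> (y - T (x k)) \<le> norm s * norm (y - T (x k))" by (rule norm_cauchy_schwarz)
    also have "\<dots> \<le> D * (a * (2 * D))"
      using \<xi>_bound[of k] gs a D_nonneg unfolding s_def[symmetric] y by (intro mult_mono) auto
    finally have s1: "s \<bullet> (y - T (x k)) \<le> D * (2 * D) * a" by (simp add: mult_ac)
    have s2: "R y - R z \<le> s \<bullet> (y - z)"
      using R_convex[of k z] unfolding s_def y_def by (simp add: inner_diff_right)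
    have s3: "R (J y) - R y \<le> M * C1 * a"
      using R_Lipschitz[of "J y" y] mult_left_mono[OF consensus_y M_nonneg]
      by (simp add: norm_minus_commute)
    have "F (J y) + R (J y) - (F z + R z) \<le> (g + s) \<bullet> (T (x k) - z)
        + (D * (2 * C1) + D * (2 * D) + M * (C1 + C2) + M * C1) * a"
      using g1 g2 g3 s1 s2 s3
      by (simp add: inner_diff_right inner_add_left distrib_right)
    then have "2 * a * (F (J y) + R (J y) - (F z + R z)) \<le> 2 * a * ((g + s) \<bullet> (T (x k) - z)
        + (D * (2 * C1) + D * (2 * D) + M * (C1 + C2) + M * C1) * a)"
      using a by (intro mult_left_mono) auto
    also have "\<dots> = 2 * a * ((g + s) \<bullet> (T (x k) - z)) + (C - 4 * D\<^sup>2) * a\<^sup>2"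
      unfolding C_def by (simp add: distrib_left power2_eq_square)
    also have "\<dots> \<le> (norm (x k - z))\<^sup>2 - (norm (y - z))\<^sup>2 + C * a\<^sup>2"
      using dist by (simp add: left_diff_distrib)
    finally show ?thesis unfolding a_def y_def .
  qed
  then show ?thesis using that C by blast
qed

end

section \<open>Proximal points and isolated limit points\<close>

text \<open>
  The point \<open>u + a *\<^sub>R v\<close> whose proximal point is \<open>u\<close> encodes the subgradient \<open>v\<close>; expanding the two
  squares in the minimality of \<open>u\<close> leaves the error \<open>(norm (y - u))\<^sup>2\<close>.
\<close>

lemma prox_quadratic_minorant:
  fixes h :: "'a::real_inner \<Rightarrow> real"
  assumes u: "u \<in> prox a (\<lambda>y. ereal (h y)) (u + a *\<^sub>R v)" and a: "0 < a"
  shows "h u + v \<bullet> (y - u) - 1 / (2 * a) * (norm (y - u))\<^sup>2 \<le> h y"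
proof -
  have "\<not> ereal a * ereal (h y) + ereal (1/2 * (norm (y - (u + a *\<^sub>R v)))\<^sup>2)
      < ereal a * ereal (h u) + ereal (1/2 * (norm (u - (u + a *\<^sub>R v)))\<^sup>2)"
    using u unfolding prox_def is_arg_min_def by blast
  then have "a * h u + 1/2 * (norm (0 - a *\<^sub>R v))\<^sup>2 \<le> a * h y + 1/2 * (norm ((y - u) - a *\<^sub>R v))\<^sup>2"
    by (simp add: diff_diff_eq)
  then have "a * h u \<le> a * h y + 1/2 * (norm (y - u))\<^sup>2 - a * (v \<bullet> (y - u))"
    unfolding power2_norm_diff_scaleR by (simp add: field_simps)
  also have "\<dots> = a * (h y + 1 / (2 * a) * (norm (y - u))\<^sup>2 - v \<bullet> (y - u))"
    using a by (simp add: distrib_left right_diff_distrib)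
  finally have "h u \<le> h y + 1 / (2 * a) * (norm (y - u))\<^sup>2 - v \<bullet> (y - u)" using a by simp
  then show ?thesis by simp
qed

text \<open>
  If the sequence left a small ball around \<open>l\<close> infinitely often, then, returning to \<open>l\<close> again and
  again with steps that tend to zero, it would visit infinitely often an annulus around \<open>l\<close> that
  contains no limit point.
\<close>

lemma isolated_limit_point_imp_tendsto:
  fixes x :: "nat \<Rightarrow> 'a::euclidean_space"
  assumes steps: "(\<lambda>k. x (Suc k) - x k) \<longlonglongrightarrow> 0"
    and isolated: "l isolated_in limit_points x"
  shows "x \<longlonglongrightarrow> l"
proof -
  obtain e where e: "0 < e" "\<And>y. y \<in> limit_points x \<Longrightarrow> dist l y < e \<Longrightarrow> y = l"
    and l: "l \<in> limit_points x"
    using isolated unfolding isolated_in_dist_Ex_iff by blast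
  obtain \<phi> where \<phi>: "strict_mono \<phi>" "(x \<circ> \<phi>) \<longlonglongrightarrow> l"
    using l unfolding limit_points_def by blast
  show ?thesis
  proof (rule ccontr)
    assume "\<not> x \<longlonglongrightarrow> l"
    then obtain c where c: "c > 0" "\<And>N. \<exists>k\<ge>N. c \<le> dist (x k) l"
      unfolding lim_sequentially by (auto simp: not_less)
    define d where "d = min c (e / 2)"
    have d: "0 < d" "d < e" "d \<le> c" unfolding d_def using e(1) c(1) by auto
    obtain N where N: "\<And>k. k \<ge> N \<Longrightarrow> norm (x (Suc k) - x k) < d / 2"
      using LIMSEQ_D[OF steps, of "d / 2"] d by auto
    define A where "A = {y. d / 2 \<le> dist y l \<and> dist y l \<le> d}"
    have "\<exists>k\<ge>n. x k \<in> A" for n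
    proof -
      obtain M where M: "\<And>k. k \<ge> M \<Longrightarrow> dist (x (\<phi> k)) l < d / 2"
        using metric_LIMSEQ_D[OF \<phi>(2), of "d / 2"] d by auto
      define n' where "n' = \<phi> (max M (max n N))"
      have n': "max n N \<le> n'" "dist (x n') l < d / 2"
        unfolding n'_def using M seq_suble[OF \<phi>(1), of "max M (max n N)"] by auto
      obtain k0 where k0: "k0 \<ge> n'" "c \<le> dist (x k0) l" using c(2) by blast
      \<comment> \<open>the first exit from the inner ball: a step shorter than \<open>d / 2\<close> cannot leave the outer one\<close>
      define k where "k = (LEAST k. n' \<le> k \<and> d / 2 \<le> dist (x k) l)"
      have k: "n' \<le> k \<and> d / 2 \<le> dist (x k) l"
        unfolding k_def by (rule LeastI[of _ k0]) (use k0 d in auto)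
      have "k \<noteq> n'" using k n' by auto
      then obtain j where j: "k = Suc j" "n' \<le> j" using k by (cases k) auto
      have "\<not> (n' \<le> j \<and> d / 2 \<le> dist (x j) l)"
        using not_less_Least[of j "\<lambda>k. n' \<le> k \<and> d / 2 \<le> dist (x k) l"] j unfolding k_def[symmetric] by auto
      then have "dist (x j) l < d / 2" using j by auto
      moreover have "dist (x k) (x j) < d / 2" using N[of j] j n' by (simp add: dist_norm)
      ultimately have "dist (x k) l \<le> d" using dist_triangle[of "x k" l "x j"] by linarith
      then show ?thesis unfolding A_def using k n'(1) by (intro exI[of _ k]) auto
    qed
    then have "infinite {k. x k \<in> A}" unfolding infinite_nat_iff_unbounded_le by blast
    from infinite_enumerate[OF this] obtain \<psi> :: "nat \<Rightarrow> nat"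
      where \<psi>: "strict_mono \<psi>" "\<And>n. x (\<psi> n) \<in> A" by auto
    have "A = cball l d - ball l (d / 2)" unfolding A_def by (auto simp: dist_commute)
    then have "compact A" by (simp add: compact_diff)
    then obtain y \<tau> where y: "y \<in> A" "strict_mono \<tau>" "((x \<circ> \<psi>) \<circ> \<tau>) \<longlonglongrightarrow> y"
      using \<psi>(2) unfolding compact_def by (metis comp_apply)
    then have "y \<in> limit_points x"
      unfolding limit_points_def using strict_mono_o[OF \<psi>(1) y(2)] by (auto simp: o_assoc)
    then have "y = l" using e(2) y(1) d unfolding A_def by (auto simp: dist_commute)
    then show False using y(1) d unfolding A_def by simp
  qed
qed

context
  fixes L \<epsilon> :: real and \<alpha> :: "nat \<Rightarrow> real"
  assumes L: "0 < L" and eps: "0 < \<epsilon>" "\<epsilon> \<le> 1"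
    and alpha: "\<And>k. \<alpha> k = 1 / (L * (real k + 1) powr \<epsilon>)"
begin

lemma stepsize_powr: "\<alpha> k = 1 / L * real (Suc k) powr - \<epsilon>"
  by (simp add: alpha powr_minus_divide add.commute)

lemma stepsize_pos: "0 < \<alpha> k"
  using L by (simp add: alpha)

lemma stepsize_dec: "\<alpha> (Suc k) \<le> \<alpha> k"
proof -
  have "real (Suc (Suc k)) powr - \<epsilon> \<le> real (Suc k) powr - \<epsilon>"
    using eps by (intro powr_mono2') auto
  then show ?thesis unfolding stepsize_powr using L by (intro mult_left_mono) auto
qed

lemma stepsize_tendsto_0: "\<alpha> \<longlonglongrightarrow> 0"
proof -
  have "filterlim (\<lambda>k. real (Suc k)) at_top sequentially"
    by (rule filterlim_compose[OF filterlim_real_sequentially filterlim_Suc])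
  then have "(\<lambda>k. real (Suc k) powr - \<epsilon>) \<longlonglongrightarrow> 0" using eps by (intro tendsto_neg_powr) auto
  from tendsto_mult_left[OF this, of "1 / L"] show ?thesis unfolding stepsize_powr[abs_def] by simp
qed

lemma stepsize_ratio_tendsto_1: "(\<lambda>k. \<alpha> k / \<alpha> (Suc k)) \<longlonglongrightarrow> 1"
proof -
  have "(\<lambda>k. (1 + inverse (real (Suc k))) powr \<epsilon>) \<longlonglongrightarrow> (1 + 0) powr \<epsilon>"
    by (intro tendsto_intros LIMSEQ_inverse_real_of_nat) auto
  moreover have "\<alpha> k / \<alpha> (Suc k) = (1 + inverse (real (Suc k))) powr \<epsilon>" for k
  proof -
    have "\<alpha> k / \<alpha> (Suc k) = real (Suc (Suc k)) powr \<epsilon> / real (Suc k) powr \<epsilon>"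
      unfolding alpha using L by (simp add: field_simps add.commute)
    also have "\<dots> = (real (Suc (Suc k)) / real (Suc k)) powr \<epsilon>" by (rule powr_divide[symmetric])
    also have "real (Suc (Suc k)) / real (Suc k) = 1 + inverse (real (Suc k))"
      by (simp add: field_simps)
    finally show ?thesis .
  qed
  ultimately show ?thesis by simp
qed

lemma stepsize_not_summable: "\<not> summable \<alpha>"
proof
  assume "summable \<alpha>"
  then have "summable (\<lambda>k. L * \<alpha> k)" by (rule summable_mult)
  moreover have "L * \<alpha> k = real (Suc k) powr - \<epsilon>" for k unfolding stepsize_powr using L by simp
  ultimately have "summable (\<lambda>k. real (Suc k) powr - \<epsilon>)" by simp
  then have "summable (\<lambda>k. real k powr - \<epsilon>)"
    using summable_Suc_iff[of "\<lambda>k. real k powr - \<epsilon>"] by simp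
  then show False using eps by (simp add: summable_real_powr_iff)
qed

end

section \<open>Ergodic rates\<close>

lemma sum_powr_ge:
  assumes "0 \<le> s"
  shows "real (Suc K) powr (1 - s) \<le> (\<Sum>k\<le>K. real (Suc k) powr - s)"
proof -
  have "(\<Sum>k\<le>K. real (Suc K) powr - s) \<le> (\<Sum>k\<le>K. real (Suc k) powr - s)"
    using assms by (intro sum_mono powr_mono2') auto
  moreover have "real (Suc K) * real (Suc K) powr - s = real (Suc K) powr (1 - s)"
    using powr_add[of "real (Suc K)" 1 "- s"] by simp
  ultimately show ?thesis by simp
qed

text \<open>
  By the mean value theorem each summand is at most \<open>1 / (1 - s)\<close> times the increment of
  \<open>z powr (1 - s)\<close> over the preceding unit interval.
\<close>

lemma sum_powr_le:
  assumes s: "0 < s" "s < 1"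
  shows "(\<Sum>k\<le>K. real (Suc k) powr - s) \<le> real (Suc K) powr (1 - s) / (1 - s)"
proof (induction K)
  case 0
  then show ?case using s by simp
next
  case (Suc K)
  define u where "u = real (Suc K)"
  have u: "0 < u" unfolding u_def by simp
  have "\<exists>z>u. z < u + 1 \<and>
      (u + 1) powr (1 - s) - u powr (1 - s) = (u + 1 - u) * ((1 - s) * z powr (1 - s - 1))"
    using u by (intro MVT2 has_real_derivative_powr) auto
  then obtain z where z: "u < z" "z < u + 1"
      "(u + 1) powr (1 - s) - u powr (1 - s) = (1 - s) * z powr - s" by auto
  have "(u + 1) powr - s \<le> z powr - s" using z u s by (intro powr_mono2') auto
  then have "(1 - s) * (u + 1) powr - s \<le> (u + 1) powr (1 - s) - u powr (1 - s)"
    using s unfolding z(3) by (simp add: mult_left_mono)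
  then have "(u + 1) powr - s \<le> ((u + 1) powr (1 - s) - u powr (1 - s)) / (1 - s)"
    using s by (simp add: pos_le_divide_eq mult.commute)
  then have "u powr (1 - s) / (1 - s) + (u + 1) powr - s \<le> (u + 1) powr (1 - s) / (1 - s)"
    by (simp add: diff_divide_distrib)
  moreover have "real (Suc (Suc K)) = u + 1" unfolding u_def by simp
  ultimately show ?case using Suc.IH unfolding u_def by simp
qed

lemma sum_inverse_Suc: "(\<Sum>k\<le>K. real (Suc k) powr - 1) = harm (Suc K)"
proof -
  have "harm (Suc K) = (\<Sum>k\<in>Suc ` {..K}. inverse (real k))"
    unfolding harm_def image_Suc_atMost by simp
  also have "\<dots> = (\<Sum>k\<le>K. inverse (real (Suc k)))" by (simp add: sum.reindex)
  also have "\<dots> = (\<Sum>k\<le>K. real (Suc k) powr - 1)" by (simp add: powr_minus)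
  finally show ?thesis ..
qed

lemma harm_le_1_plus_ln: "0 < n \<Longrightarrow> harm n \<le> 1 + ln (real n)"
  using decseqD[OF decseq_harm_diff_ln, of 0 "n - 1"] by (simp add: harm_def)

text \<open>
  Summing the hypothesis telescopes the squared distances \<open>a\<close>, so the weighted gap is governed by
  the sums of the weights and of their squares.
\<close>

lemma weighted_average_gap:
  fixes a b S :: "nat \<Rightarrow> real"
  assumes step: "\<And>k. 2 * b k * (S k - l) \<le> a k - a (Suc k) + C * (b k)\<^sup>2"
    and S: "\<And>k. l \<le> S k" and b: "\<And>k. 0 < b k" and a: "\<And>k. 0 \<le> a k"
  defines "gap \<equiv> \<lambda>K. (\<Sum>k\<le>K. b k * S k) / (\<Sum>k\<le>K. b k) - l"
  shows "0 \<le> gap K" and "gap K \<le> (a 0 + C * (\<Sum>k\<le>K. (b k)\<^sup>2)) / (2 * (\<Sum>k\<le>K. b k))"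
proof -
  have pos: "0 < (\<Sum>k\<le>K. b k)" using b by (intro sum_pos) auto
  have gap: "gap K = (\<Sum>k\<le>K. b k * (S k - l)) / (\<Sum>k\<le>K. b k)"
    unfolding gap_def using pos
    by (simp add: right_diff_distrib sum_subtractf diff_divide_distrib flip: sum_distrib_right)
  show "0 \<le> gap K"
    unfolding gap using pos b S by (intro divide_nonneg_pos sum_nonneg mult_nonneg_nonneg) (auto intro: less_imp_le)
  have "2 * (\<Sum>k\<le>K. b k * (S k - l)) = (\<Sum>k\<le>K. 2 * b k * (S k - l))"
    by (simp add: sum_distrib_left mult.assoc)
  also have "\<dots> \<le> (\<Sum>k\<le>K. (a k - a (Suc k)) + C * (b k)\<^sup>2)" by (intro sum_mono step)
  also have "\<dots> = a 0 - a (Suc K) + C * (\<Sum>k\<le>K. (b k)\<^sup>2)"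
    by (simp add: sum.distrib sum_telescope sum_distrib_left)
  finally have "2 * (\<Sum>k\<le>K. b k * (S k - l)) \<le> a 0 + C * (\<Sum>k\<le>K. (b k)\<^sup>2)"
    using a[of "Suc K"] by linarith
  then have "2 * (\<Sum>k\<le>K. b k * (S k - l)) / (2 * (\<Sum>k\<le>K. b k)) \<le> (a 0 + C * (\<Sum>k\<le>K. (b k)\<^sup>2)) / (2 * (\<Sum>k\<le>K. b k))"
    using pos by (intro divide_right_mono) auto
  then show "gap K \<le> (a 0 + C * (\<Sum>k\<le>K. (b k)\<^sup>2)) / (2 * (\<Sum>k\<le>K. b k))"
    unfolding gap by simp
qed

lemma converges_at_rateI:
  fixes e :: "nat \<Rightarrow> real"
  assumes s: "\<And>K. s K = ereal (l + e K)" and nonneg: "\<And>K. 0 \<le> e K"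
    and bound: "\<And>K. K \<ge> N \<Longrightarrow> e K \<le> c * \<rho> K" and \<rho>: "\<rho> \<longlonglongrightarrow> 0" and c: "0 \<le> c"
  shows "converges_at_rate s (ereal l) \<rho>"
proof -
  have ev: "eventually (\<lambda>K. norm (e K) \<le> c * \<rho> K) sequentially"
    using bound nonneg by (intro eventually_sequentiallyI[of N]) simp
  have "e \<longlonglongrightarrow> 0"
    using tendsto_mult_left[OF \<rho>, of c] by (intro Lim_null_comparison[OF ev]) simp
  then have "(\<lambda>K. ereal (l + e K)) \<longlonglongrightarrow> ereal (l + 0)" by (intro tendsto_intros)
  moreover have "s = (\<lambda>K. ereal (l + e K))" using s by (rule ext)
  ultimately have "s \<longlonglongrightarrow> ereal l" by simp
  moreover have "(\<lambda>K. real_of_ereal (s K - ereal l)) \<in> O(\<rho>)"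
  proof (rule bigoI[of _ c])
    show "eventually (\<lambda>K. norm (real_of_ereal (s K - ereal l)) \<le> c * norm (\<rho> K)) sequentially"
      using ev
    proof (rule eventually_mono)
      fix K assume "norm (e K) \<le> c * \<rho> K"
      also have "\<dots> \<le> c * norm (\<rho> K)" using c by (intro mult_left_mono) auto
      finally show "norm (real_of_ereal (s K - ereal l)) \<le> c * norm (\<rho> K)" by (simp add: s)
    qed
  qed
  ultimately show ?thesis unfolding converges_at_rate_def by simp
qed

context
  fixes L \<epsilon> A C l :: real and \<alpha> e :: "nat \<Rightarrow> real" and s :: "nat \<Rightarrow> ereal"
  assumes L: "0 < L"
    and alpha: "\<And>k. \<alpha> k = 1 / L * real (Suc k) powr - \<epsilon>"
    and s: "\<And>K. s K = ereal (l + e K)" and nonneg: "\<And>K. 0 \<le> e K"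
    and A: "0 \<le> A" and C: "0 \<le> C"
    and gap: "\<And>K. e K \<le> (A + C * (\<Sum>k\<le>K. (\<alpha> k)\<^sup>2)) / (2 * (\<Sum>k\<le>K. \<alpha> k))"
begin

lemma gap_le:
  assumes "(\<Sum>k\<le>K. real (Suc k) powr - (2 * \<epsilon>)) \<le> U" and "V \<le> (\<Sum>k\<le>K. real (Suc k) powr - \<epsilon>)" "0 < V"
  shows "e K \<le> (A + C / L\<^sup>2 * U) * (L / 2) / V"
proof -
  have sq: "(\<Sum>k\<le>K. (\<alpha> k)\<^sup>2) = 1 / L\<^sup>2 * (\<Sum>k\<le>K. real (Suc k) powr - (2 * \<epsilon>))"
    unfolding alpha sum_distrib_left power_mult_distrib
    by (intro sum.cong refl) (simp add: power2_eq_square flip: powr_add)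
  have "e K \<le> (A + C * (\<Sum>k\<le>K. (\<alpha> k)\<^sup>2)) / (2 * (\<Sum>k\<le>K. \<alpha> k))" by (rule gap)
  also have "\<dots> \<le> (A + C / L\<^sup>2 * U) / (2 * (1 / L * V))"
  proof (rule frac_le)
    show "0 \<le> A + C / L\<^sup>2 * U"
    proof -
      have "0 \<le> (\<Sum>k\<le>K. real (Suc k) powr - (2 * \<epsilon>))" by (intro sum_nonneg) auto
      then show ?thesis using assms(1) A C by simp
    qed
    show "A + C * (\<Sum>k\<le>K. (\<alpha> k)\<^sup>2) \<le> A + C / L\<^sup>2 * U"
      unfolding sq using mult_left_mono[OF assms(1), of "C / L\<^sup>2"] C by simp
    show "0 < 2 * (1 / L * V)" using L assms(3) by simp
    show "2 * (1 / L * V) \<le> 2 * (\<Sum>k\<le>K. \<alpha> k)"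
      unfolding alpha using assms(2) L
      by (simp only: sum_distrib_left[symmetric]) (intro mult_left_mono, auto)
  qed
  also have "\<dots> = (A + C / L\<^sup>2 * U) * (L / 2) / V" using L assms(3) by (simp add: field_simps)
  finally show ?thesis .
qed

lemma powr_rate_tendsto_0: "0 < t \<Longrightarrow> (\<lambda>K. 1 / real K powr t) \<longlonglongrightarrow> 0"
  using tendsto_neg_powr[OF _ filterlim_real_sequentially, of "- t"] by (simp add: powr_minus_divide)

text \<open>
  The squares of the step sizes have partial sums of order \<open>K powr (1 - 2 * \<epsilon>)\<close>, \<open>ln K\<close> or 1 according
  as \<open>\<epsilon>\<close> lies below, at or above \<open>1 / 2\<close>; the step sizes themselves have partial sums of order
  \<open>K powr (1 - \<epsilon>)\<close>, or \<open>ln K\<close> for \<open>\<epsilon> = 1\<close>.  The rates are the quotients.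
\<close>

lemma rate_below_half:
  assumes "0 < \<epsilon>" "\<epsilon> < 1/2"
  shows "converges_at_rate s (ereal l) (\<lambda>K. 1 / real K powr \<epsilon>)"
proof (rule converges_at_rateI[where N = 1 and c = "(A + C / L\<^sup>2 / (1 - 2 * \<epsilon>)) * (L / 2)", OF s nonneg])
  show "0 \<le> (A + C / L\<^sup>2 / (1 - 2 * \<epsilon>)) * (L / 2)" using A C L assms by simp
  fix K :: nat assume K: "1 \<le> K"
  define n where "n = real (Suc K)"
  have n: "1 \<le> n" unfolding n_def by simp
  have "e K \<le> (A + C / L\<^sup>2 * (n powr (1 - 2 * \<epsilon>) / (1 - 2 * \<epsilon>))) * (L / 2) / n powr (1 - \<epsilon>)"
    unfolding n_def using assms by (intro gap_le sum_powr_le sum_powr_ge) auto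
  also have "\<dots> \<le> (A * n powr (1 - 2 * \<epsilon>) + C / L\<^sup>2 * (n powr (1 - 2 * \<epsilon>) / (1 - 2 * \<epsilon>))) * (L / 2) / n powr (1 - \<epsilon>)"
  proof -
    have "1 \<le> n powr (1 - 2 * \<epsilon>)" using n assms by (intro ge_one_powr_ge_zero) auto
    then have "A * 1 \<le> A * n powr (1 - 2 * \<epsilon>)" using A by (intro mult_left_mono) auto
    then show ?thesis using L by (intro divide_right_mono mult_right_mono add_right_mono) auto
  qed
  also have "\<dots> = (A + C / L\<^sup>2 / (1 - 2 * \<epsilon>)) * (L / 2) * (n powr (1 - 2 * \<epsilon>) / n powr (1 - \<epsilon>))"
  proof -
    have "A * n powr (1 - 2 * \<epsilon>) + C / L\<^sup>2 * (n powr (1 - 2 * \<epsilon>) / (1 - 2 * \<epsilon>))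
        = (A + C / L\<^sup>2 / (1 - 2 * \<epsilon>)) * n powr (1 - 2 * \<epsilon>)"
      by (simp add: distrib_right)
    from this show ?thesis by (simp only:) (simp add: mult_ac)
  qed
  also have "n powr (1 - 2 * \<epsilon>) / n powr (1 - \<epsilon>) = n powr - \<epsilon>" by (simp flip: powr_diff)
  also have "\<dots> \<le> real K powr - \<epsilon>" unfolding n_def using K assms by (intro powr_mono2') auto
  finally show "e K \<le> (A + C / L\<^sup>2 / (1 - 2 * \<epsilon>)) * (L / 2) * (1 / real K powr \<epsilon>)"
    using A C L assms by (simp add: powr_minus_divide mult_left_mono)
qed (rule powr_rate_tendsto_0[OF assms(1)])

lemma rate_half:
  assumes "\<epsilon> = 1/2"
  shows "converges_at_rate s (ereal l) (\<lambda>K. ln (real K) / sqrt (real K))"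
proof (rule converges_at_rateI[where N = 3 and c = "(A + C / L\<^sup>2 * 3) * (L / 2)", OF s nonneg])
  show "0 \<le> (A + C / L\<^sup>2 * 3) * (L / 2)" using A C L by simp
  show "(\<lambda>K. ln (real K) / sqrt (real K)) \<longlonglongrightarrow> 0"
    using lim_ln_over_power[of "1/2"] by (simp add: powr_half_sqrt)
  fix K :: nat assume K: "3 \<le> K"
  have ln1: "1 \<le> ln (real K)"
    using K exp_le by (subst ln_ge_iff) auto
  have "3 * real K \<le> real K * real K" using K by (intro mult_right_mono) auto
  moreover have "1 + real K \<le> 3 * real K" using K by simp
  ultimately have "real (Suc K) \<le> real K * real K" by linarith
  then have "ln (real (Suc K)) \<le> ln (real K * real K)" using K by (subst ln_le_cancel_iff) auto
  then have ln2: "ln (real (Suc K)) \<le> 2 * ln (real K)" using K by (simp add: ln_mult)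
  have "(\<Sum>k\<le>K. real (Suc k) powr - (2 * \<epsilon>)) \<le> 3 * ln (real K)"
  proof -
    have "2 * \<epsilon> = 1" using assms by simp
    then have "(\<Sum>k\<le>K. real (Suc k) powr - (2 * \<epsilon>)) = harm (Suc K)"
      by (simp only: sum_inverse_Suc)
    then show ?thesis using harm_le_1_plus_ln[of "Suc K"] ln1 ln2 by simp
  qed
  moreover have "sqrt (real K) \<le> (\<Sum>k\<le>K. real (Suc k) powr - \<epsilon>)"
  proof -
    have "sqrt (real K) \<le> sqrt (real (Suc K))" by simp
    also have "\<dots> = real (Suc K) powr (1 - \<epsilon>)"
      unfolding assms by (simp add: powr_half_sqrt)
    also have "\<dots> \<le> (\<Sum>k\<le>K. real (Suc k) powr - \<epsilon>)" using assms by (intro sum_powr_ge) auto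
    finally show ?thesis .
  qed
  ultimately have "e K \<le> (A + C / L\<^sup>2 * (3 * ln (real K))) * (L / 2) / sqrt (real K)"
    using K by (intro gap_le) auto
  also have "\<dots> \<le> (A * ln (real K) + C / L\<^sup>2 * (3 * ln (real K))) * (L / 2) / sqrt (real K)"
    using mult_left_mono[OF ln1 A] L by (intro divide_right_mono mult_right_mono add_right_mono) auto
  also have "\<dots> = (A + C / L\<^sup>2 * 3) * (L / 2) * (ln (real K) / sqrt (real K))"
  proof -
    have "A * ln (real K) + C / L\<^sup>2 * (3 * ln (real K)) = (A + C / L\<^sup>2 * 3) * ln (real K)"
      by (simp add: distrib_right)
    from this show ?thesis by (simp only:) (simp add: mult_ac)
  qed
  finally show "e K \<le> (A + C / L\<^sup>2 * 3) * (L / 2) * (ln (real K) / sqrt (real K))" .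
qed

lemma square_sum_bounded:
  assumes "1/2 < \<epsilon>"
  obtains U where "0 \<le> U" "\<And>K. (\<Sum>k\<le>K. real (Suc k) powr - (2 * \<epsilon>)) \<le> U"
proof -
  have "summable (\<lambda>k. real k powr - (2 * \<epsilon>))" using assms by (simp add: summable_real_powr_iff)
  then have summ: "summable (\<lambda>k. real (Suc k) powr - (2 * \<epsilon>))"
    using summable_Suc_iff[of "\<lambda>k. real k powr - (2 * \<epsilon>)"] by simp
  show ?thesis
  proof (rule that[of "\<Sum>k. real (Suc k) powr - (2 * \<epsilon>)"])
    show "0 \<le> (\<Sum>k. real (Suc k) powr - (2 * \<epsilon>))" by (intro suminf_nonneg summ) auto
    show "(\<Sum>k\<le>K. real (Suc k) powr - (2 * \<epsilon>)) \<le> (\<Sum>k. real (Suc k) powr - (2 * \<epsilon>))" for K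
      by (intro sum_le_suminf summ) auto
  qed
qed

lemma rate_above_half:
  assumes "1/2 < \<epsilon>" "\<epsilon> < 1"
  shows "converges_at_rate s (ereal l) (\<lambda>K. 1 / real K powr (1 - \<epsilon>))"
proof -
  obtain U where U: "0 \<le> U" "\<And>K. (\<Sum>k\<le>K. real (Suc k) powr - (2 * \<epsilon>)) \<le> U"
    using square_sum_bounded[OF assms(1)] by blast
  show ?thesis
  proof (rule converges_at_rateI[where N = 1 and c = "(A + C / L\<^sup>2 * U) * (L / 2)", OF s nonneg])
    show "0 \<le> (A + C / L\<^sup>2 * U) * (L / 2)" using A C L U by simp
    fix K :: nat assume K: "1 \<le> K"
    have "real K powr (1 - \<epsilon>) \<le> real (Suc K) powr (1 - \<epsilon>)" using assms by (intro powr_mono2) auto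
    also have "\<dots> \<le> (\<Sum>k\<le>K. real (Suc k) powr - \<epsilon>)" using assms by (intro sum_powr_ge) auto
    finally have "e K \<le> (A + C / L\<^sup>2 * U) * (L / 2) / real K powr (1 - \<epsilon>)"
      using K U(2) by (intro gap_le) auto
    then show "e K \<le> (A + C / L\<^sup>2 * U) * (L / 2) * (1 / real K powr (1 - \<epsilon>))" by simp
  qed (use assms in \<open>auto intro: powr_rate_tendsto_0\<close>)
qed

lemma rate_one:
  assumes "\<epsilon> = 1"
  shows "converges_at_rate s (ereal l) (\<lambda>K. 1 / ln (real K))"
proof -
  obtain U where U: "0 \<le> U" "\<And>K. (\<Sum>k\<le>K. real (Suc k) powr - (2 * \<epsilon>)) \<le> U"
    using square_sum_bounded assms by auto
  show ?thesis
  proof (rule converges_at_rateI[where N = 2 and c = "(A + C / L\<^sup>2 * U) * (L / 2)", OF s nonneg])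
    show "0 \<le> (A + C / L\<^sup>2 * U) * (L / 2)" using A C L U by simp
    show "(\<lambda>K. 1 / ln (real K)) \<longlonglongrightarrow> 0"
      using tendsto_inverse_0_at_top[OF filterlim_compose[OF ln_at_top filterlim_real_sequentially]]
      by (simp add: divide_inverse)
    fix K :: nat assume K: "2 \<le> K"
    have "ln (real K) \<le> ln (real (Suc K) + 1)" using K by (subst ln_le_cancel_iff) auto
    also have "\<dots> \<le> harm (Suc K)" by (rule ln_le_harm)
    also have "\<dots> = (\<Sum>k\<le>K. real (Suc k) powr - \<epsilon>)" using sum_inverse_Suc[of K] assms by simp
    finally have "e K \<le> (A + C / L\<^sup>2 * U) * (L / 2) / ln (real K)"
      using K U(2) by (intro gap_le) auto
    then show "e K \<le> (A + C / L\<^sup>2 * U) * (L / 2) * (1 / ln (real K))" by simp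
  qed
qed

end

section \<open>Functions of stacked variables\<close>

lemma power2_norm_rows: "(norm X)\<^sup>2 = (\<Sum>i\<in>UNIV. (norm (X $ i))\<^sup>2)"
  for X :: "'a::real_inner^'n"
  by (simp add: power2_norm_eq_inner inner_vec_def)

lemma norm_le_sum_rows: "norm X \<le> (\<Sum>i\<in>UNIV. norm (X $ i))"
  for X :: "'a::real_normed_vector^'n"
  unfolding norm_vec_def by (rule L2_set_le_sum) simp

lemma sum_rows_Lipschitz:
  fixes h :: "'n::finite \<Rightarrow> 'a::real_normed_vector \<Rightarrow> real" and X Y :: "'a^'n"
  assumes "\<And>i u v. \<bar>h i u - h i v\<bar> \<le> K i * norm (u - v)" and K: "\<And>i. 0 \<le> K i"
  shows "\<bar>(\<Sum>i\<in>UNIV. h i (X $ i)) - (\<Sum>i\<in>UNIV. h i (Y $ i))\<bar> \<le> (\<Sum>i\<in>UNIV. K i) * norm (X - Y)"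
proof -
  have "\<bar>(\<Sum>i\<in>UNIV. h i (X $ i)) - (\<Sum>i\<in>UNIV. h i (Y $ i))\<bar> \<le> (\<Sum>i\<in>UNIV. \<bar>h i (X $ i) - h i (Y $ i)\<bar>)"
    unfolding sum_subtractf[symmetric] by (rule sum_abs)
  also have "\<dots> \<le> (\<Sum>i\<in>UNIV. K i * norm (X - Y))"
  proof (rule sum_mono)
    fix i
    have "norm (X $ i - Y $ i) \<le> norm (X - Y)"
      using Finite_Cartesian_Product.norm_nth_le[of "X - Y" i] by simp
    then show "\<bar>h i (X $ i) - h i (Y $ i)\<bar> \<le> K i * norm (X - Y)"
      using assms(1)[of i "X $ i" "Y $ i"] mult_left_mono[OF _ K[of i]] order_trans by blast
  qed
  finally show ?thesis by (simp add: sum_distrib_right)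
qed

lemma sum_rows_quadratic_bound:
  fixes f :: "'n::finite \<Rightarrow> real^'p \<Rightarrow> real" and X Y :: "real^'p^'n"
  assumes "\<And>i u v. \<bar>f i v - f i u - g i u \<bullet> (v - u)\<bar> \<le> L i / 2 * (norm (v - u))\<^sup>2"
    and L: "\<And>i. L i \<le> Lf"
  shows "\<bar>(\<Sum>i\<in>UNIV. f i (Y $ i)) - (\<Sum>i\<in>UNIV. f i (X $ i)) - stacked_grad g X \<bullet> (Y - X)\<bar>
    \<le> Lf / 2 * (norm (Y - X))\<^sup>2"
proof -
  have "\<bar>(\<Sum>i\<in>UNIV. f i (Y $ i)) - (\<Sum>i\<in>UNIV. f i (X $ i)) - stacked_grad g X \<bullet> (Y - X)\<bar>
      = \<bar>\<Sum>i\<in>UNIV. f i (Y $ i) - f i (X $ i) - g i (X $ i) \<bullet> (Y $ i - X $ i)\<bar>"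
    by (simp add: sum_subtractf inner_vec_def stacked_grad_def)
  also have "\<dots> \<le> (\<Sum>i\<in>UNIV. \<bar>f i (Y $ i) - f i (X $ i) - g i (X $ i) \<bullet> (Y $ i - X $ i)\<bar>)"
    by (rule sum_abs)
  also have "\<dots> \<le> (\<Sum>i\<in>UNIV. Lf / 2 * (norm ((Y - X) $ i))\<^sup>2)"
  proof (rule sum_mono)
    fix i
    have "L i / 2 * (norm (Y $ i - X $ i))\<^sup>2 \<le> Lf / 2 * (norm (Y $ i - X $ i))\<^sup>2"
      using L[of i] by (intro mult_right_mono) auto
    then show "\<bar>f i (Y $ i) - f i (X $ i) - g i (X $ i) \<bullet> (Y $ i - X $ i)\<bar> \<le> Lf / 2 * (norm ((Y - X) $ i))\<^sup>2"
      using assms(1)[of i "Y $ i" "X $ i"] by simp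
  qed
  also have "\<dots> = Lf / 2 * (norm (Y - X))\<^sup>2"
    unfolding power2_norm_rows[of "Y - X"] sum_distrib_left ..
  finally show ?thesis .
qed

lemma stacked_grad_Lipschitz:
  fixes g :: "'n::finite \<Rightarrow> real^'p \<Rightarrow> real^'p" and X Y :: "real^'p^'n"
  assumes "\<And>i. lipschitz_on (L i) UNIV (g i)" and L: "\<And>i. L i \<le> Lf" and Lf: "0 \<le> Lf"
  shows "norm (stacked_grad g X - stacked_grad g Y) \<le> Lf * norm (X - Y)"
proof -
  have "norm (stacked_grad g X - stacked_grad g Y) \<le> L2_set (\<lambda>i. Lf * norm ((X - Y) $ i)) UNIV"
    unfolding norm_vec_def[of "stacked_grad g X - stacked_grad g Y"]
  proof (rule L2_set_mono)
    fix i
    have "norm (g i (X $ i) - g i (Y $ i)) \<le> L i * norm (X $ i - Y $ i)"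
      using lipschitz_onD[OF assms(1), of "X $ i" "Y $ i" i] by (simp add: dist_norm)
    also have "\<dots> \<le> Lf * norm (X $ i - Y $ i)" using L by (intro mult_right_mono) auto
    finally show "norm ((stacked_grad g X - stacked_grad g Y) $ i) \<le> Lf * norm ((X - Y) $ i)"
      by (simp add: stacked_grad_def)
  qed simp
  also have "\<dots> = Lf * norm (X - Y)" unfolding norm_vec_def using Lf by (simp add: L2_set_right_distrib)
  finally show ?thesis .
qed

text \<open>
  Only the row \<open>i\<close> is varied.
\<close>

lemma sum_rows_minorant_imp_row_minorant:
  fixes h :: "'n::finite \<Rightarrow> 'a::real_inner \<Rightarrow> real" and X V :: "'a^'n"
  assumes minorant: "\<And>Y. (\<Sum>i\<in>UNIV. h i (X $ i)) + V \<bullet> (Y - X) - c * (norm (Y - X))\<^sup>2 \<le> (\<Sum>i\<in>UNIV. h i (Y $ i))"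
  shows "h i (X $ i) + V $ i \<bullet> (u - X $ i) - c * (norm (u - X $ i))\<^sup>2 \<le> h i u"
proof -
  define Y where "Y = X + axis i (u - X $ i)"
  have Yi: "Y $ i = u" and Yj: "\<And>j. j \<noteq> i \<Longrightarrow> Y $ j = X $ j"
    unfolding Y_def by (simp_all add: axis_def)
  have split: "(\<Sum>j\<in>UNIV. h j (Z $ j)) = h i (Z $ i) + (\<Sum>j\<in>UNIV - {i}. h j (Z $ j))" for Z :: "'a^'n"
    by (rule sum.remove) auto
  have "(\<Sum>j\<in>UNIV - {i}. h j (Y $ j)) = (\<Sum>j\<in>UNIV - {i}. h j (X $ j))"
    using Yj by (intro sum.cong) auto
  moreover have YX: "Y - X = axis i (u - X $ i)" unfolding Y_def by simp
  have "V \<bullet> (Y - X) = V $ i \<bullet> (u - X $ i)" unfolding YX by (rule inner_axis)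
  moreover have "norm (Y - X) = norm (u - X $ i)"
    unfolding YX norm_eq_sqrt_inner inner_axis by (simp add: axis_def)
  ultimately show ?thesis using minorant[of Y] Yi unfolding split[of X] split[of Y] by simp
qed

lemma diff_matrix_mult: "(mat 1 - W) ** X = X - W ** X"
  for W :: "real^'n^'n" and X :: "real^'p^'n"
proof -
  have "(mat 1 - W) ** X = mat 1 ** X - W ** X"
    by (simp add: vec_eq_iff matrix_matrix_mult_def left_diff_distrib sum_subtractf)
  then show ?thesis by simp
qed

lemma one_vector_matrix_mult: "1 v* X = (\<Sum>i\<in>UNIV. X $ i)" for X :: "real^'p^'n"
  by (simp add: vec_eq_iff vector_matrix_mult_def)

lemma sum_rows_eq_row_average:
  "(\<Sum>k\<in>UNIV. X $ k) = real CARD('n) *\<^sub>R (row_average X $ i)" for X :: "real^'p^'n"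
  unfolding row_average_row by simp

lemma connected_graph_consensus:
  assumes "connected_undirected_graph E" and "\<forall>(i, j)\<in>E. X $ i = X $ j"
  shows "X $ i = X $ j"
proof -
  have "(i, j) \<in> E\<^sup>*" using assms(1) unfolding connected_undirected_graph_def by blast
  then show ?thesis by induction (use assms(2) in force)+
qed

lemma optimal_value_attained:
  fixes f \<rho> :: "'n::finite \<Rightarrow> real^'p \<Rightarrow> real"
  assumes graph: "connected_undirected_graph E"
    and min: "\<And>u. (\<Sum>i\<in>UNIV. f i z + \<rho> i z) \<le> (\<Sum>i\<in>UNIV. f i u + \<rho> i u)"
  shows "optimal_value E f (\<lambda>i u. ereal (\<rho> i u)) = ereal (\<Sum>i\<in>UNIV. f i z + \<rho> i z)"
proof -
  define Z :: "real^'p^'n" where "Z = (\<chi> i. z)"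
  have "optimal_value E f (\<lambda>i u. ereal (\<rho> i u)) = objective f (\<lambda>i u. ereal (\<rho> i u)) Z"
    unfolding optimal_value_def
  proof (intro antisym INF_lower INF_greatest)
    show "Z \<in> {x. \<forall>(i, j)\<in>E. x $ i = x $ j}" unfolding Z_def by simp
    fix X :: "real^'p^'n" assume X: "X \<in> {x. \<forall>(i, j)\<in>E. x $ i = x $ j}"
    define u where "u = X $ undefined"
    have "X $ i = u" for i
      unfolding u_def using X by (intro connected_graph_consensus[OF graph]) simp
    then show "objective f (\<lambda>i u. ereal (\<rho> i u)) Z \<le> objective f (\<lambda>i u. ereal (\<rho> i u)) X"
      unfolding objective_def Z_def using min[of u] by simp
  qed
  then show ?thesis unfolding objective_def Z_def by simp
qed

section \<open>Convergence of the method\<close>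

theorem theorem4:
  fixes E :: "('n::finite \<times> 'n) set"
    and W :: "real^'n^'n"
    and f :: "'n \<Rightarrow> real^'p \<Rightarrow> real"
    and g :: "'n \<Rightarrow> real^'p \<Rightarrow> real^'p"
    and r :: "'n \<Rightarrow> real^'p \<Rightarrow> ereal"
    and L B Br :: "'n \<Rightarrow> real"
    and Lf \<epsilon> :: real
    and \<alpha> :: "nat \<Rightarrow> real"
    and x \<xi> :: "nat \<Rightarrow> real^'p^'n"
  assumes graph: "connected_undirected_graph E"
    and mixing: "mixing_matrix E W"
    and grad: "\<And>i z. GDERIV (f i) z :> g i z"
    and L_pos: "\<And>i. L i > 0"
    and lipschitz: "\<And>i. lipschitz_on (L i) UNIV (g i)"
    and r_range: "\<And>i z. r i z \<noteq> -\<infinity>"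
    and proper: "\<And>i. proper_fun (\<lambda>z. ereal (f i z) + r i z)"
    and lsc: "\<And>i. lower_semicontinuous (\<lambda>z. ereal (f i z) + r i z)"
    and coercive: "\<And>i. coercive (\<lambda>z. ereal (f i z) + r i z)"
    and Lf: "Lf = Max (range L)"
    and B_pos: "\<And>i. B i > 0"
    and Br_pos: "\<And>i. Br i > 0"
    and grad_bound: "\<And>i z. norm (g i z) \<le> B i"
    and subgrad_bound: "\<And>i z v. v \<in> limiting_subdiff (r i) z \<Longrightarrow> norm v \<le> Br i"
    and cases: "(\<forall>i. convex_fun (r i)) \<or> min_eigenvalue W > 0"
    and eps: "0 < \<epsilon>" "\<epsilon> \<le> 1"
    and alpha: "\<And>k. \<alpha> k = 1 / (Lf * (real k + 1) powr \<epsilon>)"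
    and step: "\<And>k. x (Suc k) \<in>
                 prox (\<alpha> k) (separable_sum r) (W ** x k - \<alpha> k *\<^sub>R stacked_grad g (x k))"
    and xi: "\<And>k. x (Suc k) = W ** x k - \<alpha> k *\<^sub>R (stacked_grad g (x k) + \<xi> (Suc k))"
  shows
    \<comment> \<open>the elements \<open>\<xi> (Suc k)\<close>, determined by the proximal steps, are subgradients\<close>
    "(\<forall>k. \<xi> (Suc k) \<in> limiting_subdiff (separable_sum r) (x (Suc k)))
     \<and>
     \<comment> \<open>(a)\<close>
     (\<exists>l::real. (\<lambda>k. lyapunov W f r (\<alpha> k) (x k)) \<longlonglongrightarrow> ereal l \<and>
                (\<lambda>k. objective f r (x k)) \<longlonglongrightarrow> ereal l)
     \<and>
     \<comment> \<open>(b)\<close>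
     ((\<forall>i. convex_fun (r i)) \<longrightarrow>
        summable (\<lambda>k. (inverse (\<alpha> k) * (1 + min_eigenvalue W) - Lf) * (norm (x (Suc k) - x k))\<^sup>2))
     \<and>
     (min_eigenvalue W > 0 \<longrightarrow>
        summable (\<lambda>k. (inverse (\<alpha> k) * min_eigenvalue W - Lf) * (norm (x (Suc k) - x k))\<^sup>2))
     \<and>
     \<comment> \<open>(c)\<close>
     ((\<exists>Lr>0. \<exists>k\<^sub>0::nat>0. \<forall>k>k\<^sub>0. norm (\<xi> (Suc k) - \<xi> k) \<le> Lr * norm (x (Suc k) - x k)) \<longrightarrow>
        (\<lambda>k. 1 v* (stacked_grad g (x k) + \<xi> (Suc k))) \<longlonglongrightarrow> 0 \<and>
        (\<forall>l \<in> limit_points x. stationary_point g r l))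
     \<and>
     \<comment> \<open>(d)\<close>
     ((\<exists>l. l isolated_in limit_points x) \<longrightarrow> convergent x)
     \<and>
     \<comment> \<open>(e)\<close>
     ((\<forall>i. convex_on UNIV (f i)) \<and> (\<forall>i. convex_fun (r i)) \<and> min_eigenvalue W > 0 \<longrightarrow>
        (\<epsilon> < 1/2 \<longrightarrow>
           converges_at_rate (ergodic_value f r \<alpha> x) (optimal_value E f r)
             (\<lambda>K. 1 / real K powr \<epsilon>)) \<and>
        (\<epsilon> = 1/2 \<longrightarrow>
           converges_at_rate (ergodic_value f r \<alpha> x) (optimal_value E f r)
             (\<lambda>K. ln (real K) / sqrt (real K))) \<and>
        (1/2 < \<epsilon> \<and> \<epsilon> < 1 \<longrightarrow>
           converges_at_rate (ergodic_value f r \<alpha> x) (optimal_value E f r)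
             (\<lambda>K. 1 / real K powr (1 - \<epsilon>))) \<and>
        (\<epsilon> = 1 \<longrightarrow>
           converges_at_rate (ergodic_value f r \<alpha> x) (optimal_value E f r)
             (\<lambda>K. 1 / ln (real K))))"
proof -
  define lam where "lam = min_eigenvalue W"
  \<comment> \<open>any constant at least \<open>B i\<close> and strictly above \<open>Br i\<close> is a Lipschitz constant of \<open>r i\<close>\<close>
  define K where "K = (\<lambda>i. B i + Br i + 1)"
  have K: "B i \<le> K i" "Br i < K i" "0 < K i" for i
    unfolding K_def using B_pos[of i] Br_pos[of i] by auto
  have L_le: "L i \<le> Lf" for i unfolding Lf by (intro Max_ge) auto
  have Lf_pos: "0 < Lf" using L_pos L_le less_le_trans by blast
  have f_Lipschitz: "\<bar>f i u - f i v\<bar> \<le> B i * norm (u - v)" for i u v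
    by (rule bounded_gradient_imp_Lipschitz[OF grad grad_bound])

  have "\<exists>\<rho>. (\<forall>u. r i u = ereal (\<rho> u)) \<and> (\<forall>u v. \<bar>\<rho> u - \<rho> v\<bar> \<le> K i * norm (u - v))" for i
  proof (rule bounded_subgradients_imp_Lipschitz[where f = "f i" and B = "B i" and Br = "Br i"])
    show "\<exists>z. r i z \<noteq> \<infinity>" using proper[of i] unfolding proper_fun_def by auto
    show "norm v \<le> Br i" if "v \<in> regular_subdiff (r i) z" for z v
      using subgrad_bound regular_subdiff_subset_limiting that by blast
  qed (use r_range lsc coercive f_Lipschitz K in auto)
  then obtain \<rho> where "\<And>i u. r i u = ereal (\<rho> i u)"
      and \<rho>_Lipschitz: "\<And>i u v. \<bar>\<rho> i u - \<rho> i v\<bar> \<le> K i * norm (u - v)"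
    by metis
  then have r: "r = (\<lambda>i u. ereal (\<rho> i u))" by (intro ext)

  define F where "F = (\<lambda>X :: real^'p^'n. \<Sum>i\<in>UNIV. f i (X $ i))"
  define R where "R = (\<lambda>X :: real^'p^'n. \<Sum>i\<in>UNIV. \<rho> i (X $ i))"
  have sep: "separable_sum r X = ereal (R X)" for X
    unfolding separable_sum_def r R_def by simp
  have obj: "objective f r X = ereal (F X + R X)" for X
    unfolding objective_def r F_def R_def by (simp add: sum.distrib)

  have \<alpha>_pos: "0 < \<alpha> k" for k by (rule stepsize_pos[OF Lf_pos eps alpha])
  have R_minorant: "R (x (Suc k)) + \<xi> (Suc k) \<bullet> (Y - x (Suc k))
      - 1 / (2 * \<alpha> k) * (norm (Y - x (Suc k)))\<^sup>2 \<le> R Y" for k Y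
  proof (rule prox_quadratic_minorant[OF _ \<alpha>_pos])
    have "x (Suc k) + \<alpha> k *\<^sub>R \<xi> (Suc k) = W ** x k - \<alpha> k *\<^sub>R stacked_grad g (x k)"
      by (subst xi) (simp add: algebra_simps)
    moreover have "separable_sum r = (\<lambda>Y. ereal (R Y))" using sep by (rule ext)
    ultimately show "x (Suc k) \<in> prox (\<alpha> k) (\<lambda>Y. ereal (R Y)) (x (Suc k) + \<alpha> k *\<^sub>R \<xi> (Suc k))"
      using step[of k] by simp
  qed
  have row_minorant: "\<rho> i (x (Suc k) $ i) + \<xi> (Suc k) $ i \<bullet> (u - x (Suc k) $ i)
      - 1 / (2 * \<alpha> k) * (norm (u - x (Suc k) $ i))\<^sup>2 \<le> \<rho> i u" for i k u
    by (rule sum_rows_minorant_imp_row_minorant) (use R_minorant in \<open>simp add: R_def\<close>)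
  have row_subgradient: "\<xi> (Suc k) $ i \<in> regular_subdiff (r i) (x (Suc k) $ i)" for i k
    unfolding r using row_minorant
    by (intro regular_subdiffI_quadratic[where c = "1 / (2 * \<alpha> k)"]) auto
  have subgradient: "\<xi> (Suc k) \<in> limiting_subdiff (separable_sum r) (x (Suc k))" for k
  proof -
    have "\<xi> (Suc k) \<in> regular_subdiff (separable_sum r) (x (Suc k))"
      using R_minorant sep by (intro regular_subdiffI_quadratic[where c = "1 / (2 * \<alpha> k)"]) auto
    then show ?thesis using regular_subdiff_subset_limiting by blast
  qed

  have summand_min: "\<exists>z. \<forall>u. f i z + \<rho> i z \<le> f i u + \<rho> i u" for i
    using lower_semicontinuous_coercive_attains_min[OF lsc coercive, of "\<lambda>_. 0" 0 i]
    unfolding r by simp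
  then obtain \<mu> where \<mu>: "\<And>i u. f i (\<mu> i) + \<rho> i (\<mu> i) \<le> f i u + \<rho> i u" by metis
  define m where "m = (\<Sum>i\<in>UNIV. f i (\<mu> i) + \<rho> i (\<mu> i))"
  define D where "D = (\<Sum>i\<in>UNIV. B i) + (\<Sum>i\<in>UNIV. Br i)"
  define M where "M = (\<Sum>i\<in>UNIV. B i) + (\<Sum>i\<in>UNIV. K i)"
  have sums_nonneg: "0 \<le> (\<Sum>i\<in>UNIV. B i)" "0 \<le> (\<Sum>i\<in>UNIV. Br i)" "0 \<le> (\<Sum>i\<in>UNIV. K i)"
    by (intro sum_nonneg less_imp_le B_pos Br_pos K(3))+

  interpret mixing_operator "\<lambda>X :: real^'p^'n. W ** X" row_average
    by (rule mixing_matrix_operator[OF mixing])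
  interpret prox_dgd "\<lambda>X :: real^'p^'n. W ** X" row_average F R "stacked_grad g" Lf lam D M m \<alpha> x \<xi>
  proof
    show "lam * (norm X)\<^sup>2 \<le> X \<bullet> (W ** X)" for X :: "real^'p^'n"
      unfolding lam_def by (rule min_eigenvalue_le_Rayleigh_matrix[OF mixing_matrix_symmetric[OF mixing]])
    show "\<bar>F Y - F X - stacked_grad g X \<bullet> (Y - X)\<bar> \<le> Lf / 2 * (norm (Y - X))\<^sup>2" for X Y
      unfolding F_def
      by (rule sum_rows_quadratic_bound[OF Lipschitz_gradient_quadratic_bounds[OF grad lipschitz] L_le])
    show "\<bar>F X - F Y\<bar> \<le> M * norm (X - Y)" for X Y
    proof -
      have "\<bar>F X - F Y\<bar> \<le> (\<Sum>i\<in>UNIV. B i) * norm (X - Y)"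
        unfolding F_def by (rule sum_rows_Lipschitz[OF f_Lipschitz]) (use B_pos in \<open>auto intro: less_imp_le\<close>)
      also have "\<dots> \<le> M * norm (X - Y)"
        unfolding M_def using sums_nonneg by (intro mult_right_mono) auto
      finally show ?thesis .
    qed
    show "\<bar>R X - R Y\<bar> \<le> M * norm (X - Y)" for X Y
    proof -
      have "\<bar>R X - R Y\<bar> \<le> (\<Sum>i\<in>UNIV. K i) * norm (X - Y)"
        unfolding R_def by (rule sum_rows_Lipschitz[OF \<rho>_Lipschitz]) (use K in \<open>auto intro: less_imp_le\<close>)
      also have "\<dots> \<le> M * norm (X - Y)"
        unfolding M_def using sums_nonneg by (intro mult_right_mono) auto
      finally show ?thesis .
    qed
    show "0 \<le> M" unfolding M_def using sums_nonneg by simp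
    show "norm (stacked_grad g X) \<le> D" for X
    proof -
      have "norm (stacked_grad g X) \<le> (\<Sum>i\<in>UNIV. norm (stacked_grad g X $ i))" by (rule norm_le_sum_rows)
      also have "\<dots> \<le> (\<Sum>i\<in>UNIV. B i)" using grad_bound by (intro sum_mono) (simp add: stacked_grad_def)
      finally show ?thesis unfolding D_def using sums_nonneg by simp
    qed
    show "norm (\<xi> (Suc k)) \<le> D" for k
    proof -
      have "norm (\<xi> (Suc k)) \<le> (\<Sum>i\<in>UNIV. norm (\<xi> (Suc k) $ i))" by (rule norm_le_sum_rows)
      also have "\<dots> \<le> (\<Sum>i\<in>UNIV. Br i)"
        using row_subgradient regular_subdiff_subset_limiting subgrad_bound by (intro sum_mono) blast
      finally show ?thesis unfolding D_def using sums_nonneg by simp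
    qed
    show "m \<le> F X + R X" for X
      unfolding m_def F_def R_def sum.distrib[symmetric] by (intro sum_mono \<mu>)
    show "0 < \<alpha> k" for k by (rule \<alpha>_pos)
    show "\<alpha> (Suc k) \<le> \<alpha> k" for k by (rule stepsize_dec[OF Lf_pos eps alpha])
    show "\<alpha> \<longlonglongrightarrow> 0" by (rule stepsize_tendsto_0[OF Lf_pos eps alpha])
    show "(\<lambda>k. \<alpha> k / \<alpha> (Suc k)) \<longlonglongrightarrow> 1" by (rule stepsize_ratio_tendsto_1[OF Lf_pos eps alpha])
    show "x (Suc k) = W ** x k - \<alpha> k *\<^sub>R (stacked_grad g (x k) + \<xi> (Suc k))" for k by (rule xi)
  qed

  have lyap: "lyapunov W f r (\<alpha> k) X = ereal (lyap k X)" for k X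
    unfolding lyapunov_def lyap_def sep sq_seminorm_def diff_matrix_mult
    by (simp add: F_def)

  have R_convex: "R (x (Suc k)) + \<xi> (Suc k) \<bullet> (Y - x (Suc k)) \<le> R Y"
    if "\<forall>i. convex_fun (r i)" for k Y
  proof -
    have conv: "convex_on UNIV (\<rho> i)" for i using that unfolding r convex_fun_ereal_iff by blast
    have "(\<Sum>i\<in>UNIV. \<rho> i (x (Suc k) $ i) + \<xi> (Suc k) $ i \<bullet> (Y $ i - x (Suc k) $ i)) \<le> (\<Sum>i\<in>UNIV. \<rho> i (Y $ i))"
      by (intro sum_mono quadratic_minorant_imp_subgradient[OF conv row_minorant])
    then show ?thesis unfolding R_def by (simp add: sum.distrib inner_vec_def)
  qed
  have descent_convex: "R (x (Suc k)) \<le> R (x k) + \<xi> (Suc k) \<bullet> (x (Suc k) - x k)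
      + (1 - 1) / (2 * \<alpha> k) * (norm (x (Suc k) - x k))\<^sup>2" if "\<forall>i. convex_fun (r i)" for k
    using R_convex[OF that, of k "x k"] by (simp add: inner_diff_right)
  have descent_nonconvex: "R (x (Suc k)) \<le> R (x k) + \<xi> (Suc k) \<bullet> (x (Suc k) - x k)
      + (1 - 0) / (2 * \<alpha> k) * (norm (x (Suc k) - x k))\<^sup>2" for k
    using R_minorant[of k "x k"] by (simp add: inner_diff_right norm_minus_commute)
  have lam_convex: "0 < 1 + lam" unfolding lam_def using mixing_matrix_min_eigenvalue[OF mixing] by simp

  have part_b1: "summable (\<lambda>k. (inverse (\<alpha> k) * (1 + lam) - Lf) * (norm (x (Suc k) - x k))\<^sup>2)"
    if "\<forall>i. convex_fun (r i)"
    by (rule lyap_convergence(2)[OF lam_convex descent_convex[OF that]])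
  have part_b2: "summable (\<lambda>k. (inverse (\<alpha> k) * lam - Lf) * (norm (x (Suc k) - x k))\<^sup>2)"
    if "0 < lam"
    using lyap_convergence(2)[OF _ descent_nonconvex] that by simp
  have limit: "\<exists>l. (\<lambda>k. lyap k (x k)) \<longlonglongrightarrow> l \<and> (\<lambda>k. F (x k) + R (x k)) \<longlonglongrightarrow> l"
    using cases
  proof
    assume "\<forall>i. convex_fun (r i)"
    then show ?thesis by (intro lyap_convergence(1)[OF lam_convex descent_convex])
  next
    assume "0 < min_eigenvalue W"
    then show ?thesis unfolding lam_def[symmetric]
      using lyap_convergence(1)[OF _ descent_nonconvex] by simp
  qed
  then have part_a: "\<exists>l::real. (\<lambda>k. lyapunov W f r (\<alpha> k) (x k)) \<longlonglongrightarrow> ereal l \<and>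
      (\<lambda>k. objective f r (x k)) \<longlonglongrightarrow> ereal l"
    unfolding lyap obj by (auto intro: tendsto_ereal)

  have G_Lipschitz: "norm (stacked_grad g X - stacked_grad g Y) \<le> Lf * norm (X - Y)" for X Y
    using Lf_pos by (intro stacked_grad_Lipschitz[OF lipschitz L_le]) simp
  have part_c: "(\<lambda>k. 1 v* (stacked_grad g (x k) + \<xi> (Suc k))) \<longlonglongrightarrow> 0 \<and>
        (\<forall>l \<in> limit_points x. stationary_point g r l)"
    if \<xi>_Lipschitz: "\<exists>Lr>0. \<exists>k\<^sub>0::nat>0. \<forall>k>k\<^sub>0. norm (\<xi> (Suc k) - \<xi> k) \<le> Lr * norm (x (Suc k) - x k)"
  proof -
    obtain Lr k0 where Lr: "0 < Lr" "\<And>k. k > k0 \<Longrightarrow> norm (\<xi> (Suc k) - \<xi> k) \<le> Lr * norm (x (Suc k) - x k)"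
      using \<xi>_Lipschitz by blast
    have "\<exists>c>0. summable (\<lambda>k. (inverse (\<alpha> k) * c - Lf) * (norm (x (Suc k) - x k))\<^sup>2)"
      using cases
    proof
      assume "\<forall>i. convex_fun (r i)"
      then show ?thesis using part_b1 lam_convex by (intro exI[of _ "1 + lam"]) simp
    next
      assume "0 < min_eigenvalue W"
      then show ?thesis using part_b2 unfolding lam_def by (intro exI[of _ "min_eigenvalue W"]) simp
    qed
    then obtain c where c: "0 < c" "summable (\<lambda>k. (inverse (\<alpha> k) * c - Lf) * (norm (x (Suc k) - x k))\<^sup>2)"
      by (elim exE conjE)
    have avg: "(\<lambda>k. row_average (stacked_grad g (x k) + \<xi> (Suc k))) \<longlonglongrightarrow> 0"
      by (rule average_direction_tendsto_0[OF c G_Lipschitz Lr(2)])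
        (use Lr(1) Lf_pos stepsize_not_summable[OF Lf_pos eps alpha] in auto)
    have one: "1 v* X = real CARD('n) *\<^sub>R (row_average X $ i)" for X :: "real^'p^'n" and i
      unfolding one_vector_matrix_mult by (rule sum_rows_eq_row_average)
    have "(\<lambda>k. 1 v* (stacked_grad g (x k) + \<xi> (Suc k))) \<longlonglongrightarrow> 0"
      using tendsto_scaleR[OF tendsto_const[of "real CARD('n)"] tendsto_vec_nth[OF avg, of undefined]]
      unfolding one[of _ undefined] by simp
    moreover have "stationary_point g r l" if "l \<in> limit_points x" for l
    proof -
      obtain \<phi> where \<phi>: "strict_mono \<phi>" "(x \<circ> \<phi>) \<longlonglongrightarrow> l"
        using \<open>l \<in> limit_points x\<close> unfolding limit_points_def by blast
      have "bounded (range (\<lambda>k. \<xi> (Suc (\<phi> k))))" unfolding bounded_iff using \<xi>_bound by auto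
      then obtain v \<tau> where \<tau>: "strict_mono \<tau>" "((\<lambda>k. \<xi> (Suc (\<phi> k))) \<circ> \<tau>) \<longlonglongrightarrow> v"
        using bounded_imp_convergent_subsequence by blast
      define \<psi> where "\<psi> = \<phi> \<circ> \<tau>"
      have \<psi>: "strict_mono \<psi>" unfolding \<psi>_def by (rule strict_mono_o[OF \<phi>(1) \<tau>(1)])
      have sub: "(\<lambda>k. z (\<psi> k)) \<longlonglongrightarrow> y" if "z \<longlonglongrightarrow> y" for z :: "nat \<Rightarrow> real^'p^'n" and y
        using LIMSEQ_subseq_LIMSEQ[OF that \<psi>] unfolding comp_def .
      have x_lim: "(\<lambda>k. x (\<psi> k)) \<longlonglongrightarrow> l"
        using LIMSEQ_subseq_LIMSEQ[OF \<phi>(2) \<tau>(1)] unfolding \<psi>_def comp_def .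
      have \<xi>_lim: "(\<lambda>k. \<xi> (Suc (\<psi> k))) \<longlonglongrightarrow> v" using \<tau>(2) unfolding \<psi>_def comp_def .
      have x_Suc_lim: "(\<lambda>k. x (Suc (\<psi> k))) \<longlonglongrightarrow> l"
        using tendsto_add[OF sub[OF step_length_tendsto_0] x_lim] by simp
      have G_lim: "(\<lambda>k. stacked_grad g (x (\<psi> k))) \<longlonglongrightarrow> stacked_grad g l"
      proof (rule LIM_zero_cancel, rule Lim_null_comparison)
        show "eventually (\<lambda>k. norm (stacked_grad g (x (\<psi> k)) - stacked_grad g l) \<le> Lf * norm (x (\<psi> k) - l)) sequentially"
          using G_Lipschitz by simp
        have "(\<lambda>k. Lf * norm (x (\<psi> k) - l)) \<longlonglongrightarrow> Lf * norm (l - l)" by (intro tendsto_intros x_lim)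
        then show "(\<lambda>k. Lf * norm (x (\<psi> k) - l)) \<longlonglongrightarrow> 0" by simp
      qed
      have "bounded_linear (row_average :: real^'p^'n \<Rightarrow> _)"
        using linear_J unfolding linear_conv_bounded_linear .
      note J_lim = bounded_linear.tendsto[OF this]
      have "l - row_average l = 0"
        using tendsto_diff[OF x_lim J_lim[OF x_lim]] sub[OF consensus_error_tendsto_0]
        by (rule LIMSEQ_unique)
      then have Jl: "row_average l = l" by simp
      define z where "z = l $ undefined"
      have z: "l $ i = z" for i
        unfolding z_def by (metis Jl row_average_row)
      have "row_average (stacked_grad g l + v) = 0"
        using J_lim[OF tendsto_add[OF G_lim \<xi>_lim]] sub[OF avg] by (rule LIMSEQ_unique)
      then have "1 v* (stacked_grad g l + v) = 0" using one[of _ undefined] by simp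
      then have "(\<Sum>i\<in>UNIV. g i z + v $ i) = 0"
        unfolding one_vector_matrix_mult by (simp add: stacked_grad_def z)
      moreover have "v $ i \<in> limiting_subdiff (r i) z" for i
      proof -
        have u_lim: "(\<lambda>k. x (Suc (\<psi> k)) $ i) \<longlonglongrightarrow> z" using tendsto_vec_nth[OF x_Suc_lim, of i] by (simp add: z)
        moreover have "(\<lambda>k. r i (x (Suc (\<psi> k)) $ i)) \<longlonglongrightarrow> r i z"
          unfolding r
        proof (rule tendsto_ereal, rule LIM_zero_cancel, rule Lim_null_comparison)
          show "eventually (\<lambda>k. norm (\<rho> i (x (Suc (\<psi> k)) $ i) - \<rho> i z) \<le> K i * norm (x (Suc (\<psi> k)) $ i - z)) sequentially"
            using \<rho>_Lipschitz by simp
          have "(\<lambda>k. K i * norm (x (Suc (\<psi> k)) $ i - z)) \<longlonglongrightarrow> K i * norm (z - z)" by (intro tendsto_intros u_lim)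
          then show "(\<lambda>k. K i * norm (x (Suc (\<psi> k)) $ i - z)) \<longlonglongrightarrow> 0" by simp
        qed
        moreover have "(\<lambda>k. \<xi> (Suc (\<psi> k)) $ i) \<longlonglongrightarrow> v $ i" by (rule tendsto_vec_nth[OF \<xi>_lim])
        moreover have "\<bar>r i z\<bar> \<noteq> \<infinity>" unfolding r by simp
        ultimately show ?thesis
          unfolding limiting_subdiff_def using row_subgradient
          by (intro CollectI conjI exI[of _ "\<lambda>k. x (Suc (\<psi> k)) $ i"] exI[of _ "\<lambda>k. \<xi> (Suc (\<psi> k)) $ i"]) auto
      qed
      ultimately show ?thesis unfolding stationary_point_def using z by blast
    qed
    ultimately show ?thesis by blast
  qed

  have part_d: "convergent x" if "\<exists>l. l isolated_in limit_points x"
    using isolated_limit_point_imp_tendsto[OF step_length_tendsto_0] that convergentI by blast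

  have part_e: "(\<epsilon> < 1/2 \<longrightarrow>
           converges_at_rate (ergodic_value f r \<alpha> x) (optimal_value E f r)
             (\<lambda>K. 1 / real K powr \<epsilon>)) \<and>
        (\<epsilon> = 1/2 \<longrightarrow>
           converges_at_rate (ergodic_value f r \<alpha> x) (optimal_value E f r)
             (\<lambda>K. ln (real K) / sqrt (real K))) \<and>
        (1/2 < \<epsilon> \<and> \<epsilon> < 1 \<longrightarrow>
           converges_at_rate (ergodic_value f r \<alpha> x) (optimal_value E f r)
             (\<lambda>K. 1 / real K powr (1 - \<epsilon>))) \<and>
        (\<epsilon> = 1 \<longrightarrow>
           converges_at_rate (ergodic_value f r \<alpha> x) (optimal_value E f r)
             (\<lambda>K. 1 / ln (real K)))"
    if f_convex: "\<forall>i. convex_on UNIV (f i)" and r_convex: "\<forall>i. convex_fun (r i)"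
  proof -
    define h where "h = (\<lambda>u. \<Sum>i\<in>UNIV. f i u + \<rho> i u)"
    \<comment> \<open>one summand is coercive and the others are continuous and bounded below, so the sum is minimised\<close>
    obtain z where z: "\<And>u. h z \<le> h u"
    proof -
      fix i0 :: 'n
      define c where "c = (\<lambda>u. \<Sum>i\<in>UNIV - {i0}. f i u + \<rho> i u)"
      have "continuous_on UNIV (\<lambda>u. f i u + \<rho> i u)" for i
      proof (rule lipschitz_on_continuous_on, rule lipschitz_onI)
        fix u v
        show "dist (f i u + \<rho> i u) (f i v + \<rho> i v) \<le> (B i + K i) * dist u v"
          using f_Lipschitz[of i u v] \<rho>_Lipschitz[of i u v] unfolding dist_norm real_norm_def distrib_right
          by linarith
      qed (use K(3)[of i] B_pos[of i] in simp)
      then have "continuous_on UNIV c" unfolding c_def by (intro continuous_on_sum) auto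
      moreover have "(\<Sum>i\<in>UNIV - {i0}. f i (\<mu> i) + \<rho> i (\<mu> i)) \<le> c u" for u
        unfolding c_def by (intro sum_mono \<mu>)
      ultimately obtain z where "\<And>u. ereal (f i0 z) + r i0 z + ereal (c z) \<le> ereal (f i0 u) + r i0 u + ereal (c u)"
        using lower_semicontinuous_coercive_attains_min[OF lsc coercive, of c _ i0] by blast
      moreover have "h u = f i0 u + \<rho> i0 u + c u" for u
        unfolding h_def c_def by (rule sum.remove) auto
      ultimately have "h z \<le> h u" for u unfolding r by simp
      then show thesis by (rule that)
    qed
    define Z :: "real^'p^'n" where "Z = (\<chi> i. z)"
    have hZ: "F Z + R Z = h z" unfolding F_def R_def Z_def h_def by (simp add: sum.distrib)
    have opt: "optimal_value E f r = ereal (h z)"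
      unfolding h_def r by (rule optimal_value_attained[OF graph]) (use z in \<open>simp add: h_def\<close>)
    have "row_average Z = Z" by (rule row_average_consensus[of _ z]) (simp add: Z_def)
    then have fixed: "W ** Z = Z" by (metis T_J)
    have F_convex: "F X + stacked_grad g X \<bullet> (Y - X) \<le> F Y" for X Y
    proof -
      have "f i (X $ i) + g i (X $ i) \<bullet> (Y $ i - X $ i) \<le> f i (Y $ i)" for i
      proof (rule quadratic_minorant_imp_subgradient[where c = "L i / 2"])
        show "convex_on UNIV (f i)" using f_convex by blast
        show "f i (X $ i) + g i (X $ i) \<bullet> (u - X $ i) - L i / 2 * (norm (u - X $ i))\<^sup>2 \<le> f i u" for u
          using Lipschitz_gradient_quadratic_bounds[OF grad lipschitz, of i u "X $ i"] by linarith
      qed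
      then have "(\<Sum>i\<in>UNIV. f i (X $ i) + g i (X $ i) \<bullet> (Y $ i - X $ i)) \<le> (\<Sum>i\<in>UNIV. f i (Y $ i))"
        by (intro sum_mono)
      then show ?thesis unfolding F_def by (simp add: sum.distrib inner_vec_def stacked_grad_def)
    qed
    obtain C where C: "0 \<le> C"
      "\<And>k. 2 * \<alpha> k * (F (row_average (x (Suc k))) + R (row_average (x (Suc k))) - (F Z + R Z))
        \<le> (norm (x k - Z))\<^sup>2 - (norm (x (Suc k) - Z))\<^sup>2 + C * (\<alpha> k)\<^sup>2"
      by (rule ergodic_step[OF F_convex R_convex[OF r_convex] fixed]) blast
    define S where "S = (\<lambda>k. F (row_average (x (Suc k))) + R (row_average (x (Suc k))))"
    have S: "h z \<le> S k" for k
    proof -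
      have "S k = h (row_average (x (Suc k)) $ undefined)"
        unfolding S_def F_def R_def h_def row_average_row by (simp add: sum.distrib)
      then show ?thesis using z by simp
    qed
    define e where "e = (\<lambda>N. (\<Sum>k\<le>N. \<alpha> k * S k) / (\<Sum>k\<le>N. \<alpha> k) - h z)"
    have step': "2 * \<alpha> k * (S k - h z) \<le> (norm (x k - Z))\<^sup>2 - (norm (x (Suc k) - Z))\<^sup>2 + C * (\<alpha> k)\<^sup>2" for k
      using C(2)[of k] unfolding S_def hZ .
    have e_nonneg: "0 \<le> e N" for N
      unfolding e_def by (rule weighted_average_gap(1)[where b = \<alpha> and S = S and l = "h z"
        and a = "\<lambda>k. (norm (x k - Z))\<^sup>2", OF step' S \<alpha>_pos zero_le_power2])
    have e_le: "e N \<le> ((norm (x 0 - Z))\<^sup>2 + C * (\<Sum>k\<le>N. (\<alpha> k)\<^sup>2)) / (2 * (\<Sum>k\<le>N. \<alpha> k))" for N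
      unfolding e_def by (rule weighted_average_gap(2)[where b = \<alpha> and S = S and l = "h z"
        and a = "\<lambda>k. (norm (x k - Z))\<^sup>2", OF step' S \<alpha>_pos zero_le_power2])
    have "ergodic_value f r \<alpha> x N = ereal (h z + e N)" for N
    proof -
      have "0 < (\<Sum>k\<le>N. \<alpha> k)" using \<alpha>_pos by (intro sum_pos) auto
      then show ?thesis unfolding ergodic_value_def obj e_def S_def by simp
    qed
    note rate_facts = Lf_pos stepsize_powr[OF Lf_pos eps alpha] this e_nonneg zero_le_power2 C(1) e_le
    show ?thesis
      unfolding opt
      using rate_below_half[OF rate_facts eps(1)] rate_half[OF rate_facts]
        rate_above_half[OF rate_facts] rate_one[OF rate_facts] by blast
  qed

  show ?thesis
    unfolding lam_def[symmetric]
    using subgradient part_a part_b1 part_b2 part_c part_d part_e by blast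
qed

end
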